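(* For every $\psi\in\Psi_1$ (and every choice of the roots $\xi_1,\xi_2,\xi_3$ entering its definition) the rational function $A_\psi\in K(\mathfrak m)$ is invariant under the adjoint action of $B$.
   Context: Setting. $K$ is an algebraically closed field of characteristic zero, $G=\mathrm{GL}(n,K)$, $B$ (resp. $N$) is the subgroup of upper triangular (resp. upper unitriangular) matrices. $P\supset B$ is a parabolic subgroup of block upper triangular matrices with diagonal blocks of sizes $(r_1,\dots,r_u)$, $r_1+\dots+r_u=n$; put $R_k=r_1+\dots+r_k$, $R_0=0$. The Lie algebra of $P$ is $\mathfrak p=\mathfrak r\oplus\mathfrak m$, with $\mathfrak r$ the block diagonal subalgebra and $\mathfrak m$ the nilradical (strictly block upper triangular matrices). $P$ (hence $B$ and $N$) acts on $\mathfrak m$ by $\mathrm{Ad}_g x=gxg^{-1}$, and on functions $f\in K[\mathfrak m]$ or $K(\mathfrak m)$ by sending $f(x)$ to $f(\mathrm{Ad}_{g^{-1}}x)$. Roots. A positive root $\varepsilon_i-\varepsilon_j$ ($1\le i<j\le n$) is identified with the pair $(i,j)$; $\Delta^+$ is the set of all positive roots. $\Delta^+_{\mathfrak r}$ is the set of $(i,j)$, $i<j$, with $i,j$ in the same diagonal block; $M=\Delta^+\setminus\Delta^+_{\mathfrak r}$ is the set of roots of $\mathfrak m$. $K[\mathfrak m]$ is the polynomial algebra in the coordinates $x_{i,j}$, $(i,j)\in M$. For roots write $\gamma'>\gamma$ if $\gamma'-\gamma\in\Delta^+$ (not an order relation); $\gamma,\gamma'$ are comparable if $\gamma'>\gamma$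 or $\gamma>\gamma'$. Base. The base $S$ is the unique subset $S\subset M$ whose elements are pairwise non-comparable and such that for each $\gamma\in M\setminus S$ there is $\xi\in S$ with $\gamma>\xi$. Minors. $\mathbb X$ is the $n\times n$ matrix with entry $x_{i,j}$ at $(i,j)\in M$ and $0$ elsewhere. For $\gamma=(a,b)\in M$ let $S_\gamma=\{(i,j)\in S: i>a,\ j<b\}=\{(i_1,j_1),\dots,(i_k,j_k)\}$; $M_\gamma$ is the minor of $\mathbb X$ with (increasingly ordered) rows $\{a,i_1,\dots,i_k\}$ and columns $\{j_1,\dots,j_k,b\}$. The set $\Phi$ and polynomials $L_\varphi$. An admissible pair is $q=(\xi,\xi')$ with $\xi=(i,j)\in S$, $\xi'=(k,l)\in S$ and $\alpha_q:=(j,k)\in\Delta^+_{\mathfrak r}$. Put $\varphi_q=\alpha_q+\xi'=(j,l)$ and $\Phi=\{\varphi_q\}$ over all admissible pairs $q$ (the pair $q$ is determined by $\varphi_q$). For $\varphi=\varphi_q$, $L_\varphi=\sum M_{\xi+\alpha_1}M_{\alpha_2+\xi'}$, the sum being over $\alpha_1,\alpha_2\in\Delta^+_{\mathfrak r}\cup\{0\}$ with $\alpha_1+\alpha_2=\alpha_q$. First series. $\Psi_1$ is the set of $\psi=(i,b)\in\Phi$ for which there exist $j>i$ and $a<b$ such that $\xi_1=(i,a)$, $\xi_2=(j,a)$, $\xi_3=(j,b)$ all lie in $S\cup\Phi$; then automatically $\xi_1,\xi_2\in\Phi$. Let $(\gamma,\gamma')$ be the admissible pair corresponding to $\xi_2$.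 For a choice of such $\xi_1,\xi_2,\xi_3$, $$A_\psi=\frac{L_\psi L_{\xi_2}}{L_{\xi_1}L_{\xi_3}}\ \text{ if }\xi_3\in\Phi,\qquad A_\psi=\frac{L_\psi L_{\xi_2}}{L_{\xi_1}M_\gamma M_{\xi_3}}\ \text{ if }\xi_3\in S.$$ *)

theory Defs
  imports
    "HOL-Library.Poly_Mapping"
    "HOL-Library.Product_Lexorder"
    "HOL-Computational_Algebra.Fraction_Field"
    "HOL-Computational_Algebra.Polynomial"
    "Jordan_Normal_Form.Determinant"
    "Jordan_Normal_Form.DL_Submatrix"
begin

text \<open>
  All row and column indices run from \<open>0\<close> to \<open>n - 1\<close>. The parabolic subgroup is given by the list
  \<open>r = [r\<^sub>1, \<dots>, r\<^sub>u]\<close> of its block sizes, and \<open>n = sum_list r\<close>.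
\<close>

section \<open>Roots\<close>

definition pos_roots :: "nat \<Rightarrow> (nat \<times> nat) set" where
  "pos_roots n = {(i, j). i < j \<and> j < n}"

definition same_block :: "nat list \<Rightarrow> nat \<Rightarrow> nat \<Rightarrow> bool" where
  "same_block r i j \<longleftrightarrow> (\<exists>k < length r. {i, j} \<subseteq> {sum_list (take k r) ..< sum_list (take (Suc k) r)})"

definition roots_r :: "nat list \<Rightarrow> (nat \<times> nat) set" where
  "roots_r r = {(i, j) \<in> pos_roots (sum_list r). same_block r i j}"

definition roots_m :: "nat list \<Rightarrow> (nat \<times> nat) set" where
  "roots_m r = pos_roots (sum_list r) - roots_r r"

text \<open>The root \<open>\<epsilon>\<^sub>i - \<epsilon>\<^sub>j\<close> as an element of the lattice spanned by the \<open>\<epsilon>\<^sub>k\<close>.\<close>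

definition root_vec :: "nat \<times> nat \<Rightarrow> nat \<Rightarrow>\<^sub>0 int" where
  "root_vec \<gamma> = Poly_Mapping.single (fst \<gamma>) 1 - Poly_Mapping.single (snd \<gamma>) 1"

definition root_gt :: "nat \<Rightarrow> nat \<times> nat \<Rightarrow> nat \<times> nat \<Rightarrow> bool" where
  "root_gt n \<gamma>' \<gamma> \<longleftrightarrow> root_vec \<gamma>' - root_vec \<gamma> \<in> root_vec ` pos_roots n"

definition is_base :: "nat list \<Rightarrow> (nat \<times> nat) set \<Rightarrow> bool" where
  "is_base r S \<longleftrightarrow> S \<subseteq> roots_m r
    \<and> (\<forall>\<gamma>\<in>S. \<forall>\<gamma>'\<in>S. \<not> root_gt (sum_list r) \<gamma>' \<gamma> \<and> \<not> root_gt (sum_list r) \<gamma> \<gamma>')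
    \<and> (\<forall>\<gamma>\<in>roots_m r - S. \<exists>\<xi>\<in>S. root_gt (sum_list r) \<gamma> \<xi>)"

text \<open>Existence and uniqueness are lemma \<open>ex1_base\<close> below.\<close>

definition base :: "nat list \<Rightarrow> (nat \<times> nat) set" where
  "base r = (THE S. is_base r S)"

definition admissible :: "nat list \<Rightarrow> (nat \<times> nat) \<times> (nat \<times> nat) \<Rightarrow> bool" where
  "admissible r q \<longleftrightarrow> fst q \<in> base r \<and> snd q \<in> base r \<and> (snd (fst q), fst (snd q)) \<in> roots_r r"

definition pair_root :: "(nat \<times> nat) \<times> (nat \<times> nat) \<Rightarrow> nat \<times> nat" where
  "pair_root q = (snd (fst q), snd (snd q))"

definition Phi :: "nat list \<Rightarrow> (nat \<times> nat) set" where
  "Phi r = pair_root ` {q. admissible r q}"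

text \<open>The admissible pair of a root of \<open>Phi r\<close>; it is unique by \<open>adm_pair_eq\<close> below.\<close>

definition adm_pair :: "nat list \<Rightarrow> nat \<times> nat \<Rightarrow> (nat \<times> nat) \<times> (nat \<times> nat)" where
  "adm_pair r \<phi> = (THE q. admissible r q \<and> pair_root q = \<phi>)"

definition Psi1 :: "nat list \<Rightarrow> (nat \<times> nat) set" where
  "Psi1 r = {(i, b) \<in> Phi r. \<exists>j>i. \<exists>a<b. {(i, a), (j, a), (j, b)} \<subseteq> base r \<union> Phi r}"


section \<open>Polynomials and rational functions on \<open>\<mm>\<close>\<close>

text \<open>
  The types provide a variable \<open>x\<^sub>i\<^sub>,\<^sub>j\<close> for every pair \<open>(i, j)\<close> of natural numbers;
  \<open>K[\<mm>]\<close> and \<open>K(\<mm>)\<close> are the subring and the subfield in the variables indexed by \<open>roots_m r\<close>.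
\<close>

type_synonym 'k mpol = "((nat \<times> nat) \<Rightarrow>\<^sub>0 nat) \<Rightarrow>\<^sub>0 'k"
type_synonym 'k mrat = "'k mpol fract"

definition Cst :: "'k \<Rightarrow> 'k::comm_ring_1 mpol" where
  "Cst c = Poly_Mapping.single 0 c"

definition Var :: "nat \<times> nat \<Rightarrow> 'k::comm_ring_1 mpol" where
  "Var v = Poly_Mapping.single (Poly_Mapping.single v 1) 1"

definition poly_m :: "nat list \<Rightarrow> 'k::comm_ring_1 mpol set" where
  "poly_m r = {p. \<forall>m \<in> Poly_Mapping.keys p. Poly_Mapping.keys m \<subseteq> roots_m r}"

definition rat_m :: "nat list \<Rightarrow> 'k::field mrat set" where
  "rat_m r = {Fract p q | p q. p \<in> poly_m r \<and> q \<in> poly_m r \<and> q \<noteq> 0}"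

definition monom_subst :: "(nat \<times> nat \<Rightarrow> 'k mpol) \<Rightarrow> ((nat \<times> nat) \<Rightarrow>\<^sub>0 nat) \<Rightarrow> 'k::comm_ring_1 mpol" where
  "monom_subst s m = (\<Prod>v\<in>Poly_Mapping.keys m. s v ^ Poly_Mapping.lookup m v)"

definition poly_subst :: "(nat \<times> nat \<Rightarrow> 'k mpol) \<Rightarrow> 'k mpol \<Rightarrow> 'k::comm_ring_1 mpol" where
  "poly_subst s p = (\<Sum>m\<in>Poly_Mapping.keys p. Cst (Poly_Mapping.lookup p m) * monom_subst s m)"

text \<open>
  The extension of an injective ring endomorphism to the field of fractions,
  see \<open>fract_ext_Fract\<close> below.
\<close>

definition fract_ext :: "('p \<Rightarrow> 'p) \<Rightarrow> 'p::idom fract \<Rightarrow> 'p fract" where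
  "fract_ext \<sigma> f = (THE w. \<exists>p q. q \<noteq> 0 \<and> f = Fract p q \<and> w = Fract (\<sigma> p) (\<sigma> q))"


section \<open>The adjoint action\<close>

definition borel_subgroup :: "nat \<Rightarrow> 'k::field mat set" where
  "borel_subgroup n = {g \<in> Units (ring_mat TYPE('k) n ()). upper_triangular g}"

definition generic_mat :: "nat list \<Rightarrow> 'k::comm_ring_1 mpol mat" where
  "generic_mat r = mat (sum_list r) (sum_list r) (\<lambda>\<gamma>. if \<gamma> \<in> roots_m r then Var \<gamma> else 0)"

text \<open>
  Sending \<open>f(x)\<close> to \<open>f(g\<^sup>-\<^sup>1 x g)\<close> substitutes for \<open>x\<^sub>i\<^sub>,\<^sub>j\<close> the entry \<open>(i, j)\<close>
  of \<open>g\<^sup>-\<^sup>1 \<bbbX> g\<close>. The variables which do not occur in \<open>K[\<mm>]\<close> are left fixed.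
\<close>

definition Ad_inv_mat :: "nat list \<Rightarrow> 'k::field mat \<Rightarrow> 'k mpol mat" where
  "Ad_inv_mat r g =
    map_mat Cst (inv\<^bsub>ring_mat TYPE('k) (sum_list r) ()\<^esub> g) * generic_mat r * map_mat Cst g"

definition act_poly :: "nat list \<Rightarrow> 'k::field mat \<Rightarrow> 'k mpol \<Rightarrow> 'k mpol" where
  "act_poly r g = poly_subst (\<lambda>\<gamma>. if \<gamma> \<in> roots_m r then Ad_inv_mat r g $$ \<gamma> else Var \<gamma>)"

definition act_rat :: "nat list \<Rightarrow> 'k::field mat \<Rightarrow> 'k mrat \<Rightarrow> 'k mrat" where
  "act_rat r g = fract_ext (act_poly r g)"

definition rat_invariants :: "nat list \<Rightarrow> 'k::field mat set \<Rightarrow> 'k mrat set" where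
  "rat_invariants r H = {f \<in> rat_m r. \<forall>g\<in>H. act_rat r g f = f}"


section \<open>The minors, the polynomials \<open>L\<close> and the rational functions \<open>A\<close>\<close>

definition base_below :: "nat list \<Rightarrow> nat \<times> nat \<Rightarrow> (nat \<times> nat) set" where
  "base_below r \<gamma> = {(i, j) \<in> base r. fst \<gamma> < i \<and> j < snd \<gamma>}"

definition minor :: "nat list \<Rightarrow> nat \<times> nat \<Rightarrow> 'k::comm_ring_1 mpol" where
  "minor r \<gamma> = det (submatrix (generic_mat r)
      (insert (fst \<gamma>) (fst ` base_below r \<gamma>)) (insert (snd \<gamma>) (snd ` base_below r \<gamma>)))"

text \<open>
  The summation runs over the pairs \<open>(\<beta>\<^sub>1, \<beta>\<^sub>2) = (\<xi> + \<alpha>\<^sub>1, \<alpha>\<^sub>2 + \<xi>')\<close>, which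
  determine \<open>(\<alpha>\<^sub>1, \<alpha>\<^sub>2)\<close>. Decompositions for which \<open>\<xi> + \<alpha>\<^sub>1\<close> or \<open>\<alpha>\<^sub>2 + \<xi>'\<close> is not a root
  do not contribute. See \<open>L_poly_eq\<close> below for the resulting explicit sum.
\<close>

definition L_poly :: "nat list \<Rightarrow> nat \<times> nat \<Rightarrow> 'k::comm_ring_1 mpol" where
  "L_poly r \<phi> = (let (\<xi>, \<xi>') = adm_pair r \<phi>; D = insert 0 (root_vec ` roots_r r) in
    \<Sum>(\<beta>\<^sub>1, \<beta>\<^sub>2) \<in> {(\<beta>\<^sub>1, \<beta>\<^sub>2). \<beta>\<^sub>1 \<in> roots_m r \<and> \<beta>\<^sub>2 \<in> roots_m r \<and>
        (\<exists>\<alpha>\<^sub>1\<in>D. \<exists>\<alpha>\<^sub>2\<in>D. \<alpha>\<^sub>1 + \<alpha>\<^sub>2 = root_vec (snd \<xi>, fst \<xi>')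
          \<and> root_vec \<beta>\<^sub>1 = root_vec \<xi> + \<alpha>\<^sub>1 \<and> root_vec \<beta>\<^sub>2 = \<alpha>\<^sub>2 + root_vec \<xi>')}.
      minor r \<beta>\<^sub>1 * minor r \<beta>\<^sub>2)"

definition A_denom :: "nat list \<Rightarrow> nat \<times> nat \<Rightarrow> nat \<times> nat \<Rightarrow> nat \<times> nat \<Rightarrow> 'k::comm_ring_1 mpol" where
  "A_denom r \<xi>\<^sub>1 \<xi>\<^sub>2 \<xi>\<^sub>3 =
    (if \<xi>\<^sub>3 \<in> Phi r then L_poly r \<xi>\<^sub>1 * L_poly r \<xi>\<^sub>3
     else L_poly r \<xi>\<^sub>1 * minor r (fst (adm_pair r \<xi>\<^sub>2)) * minor r \<xi>\<^sub>3)"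

definition A_rat ::
  "nat list \<Rightarrow> nat \<times> nat \<Rightarrow> nat \<times> nat \<Rightarrow> nat \<times> nat \<Rightarrow> nat \<times> nat \<Rightarrow> 'k::field mrat" where
  "A_rat r \<psi> \<xi>\<^sub>1 \<xi>\<^sub>2 \<xi>\<^sub>3 = Fract (L_poly r \<psi> * L_poly r \<xi>\<^sub>2) (A_denom r \<xi>\<^sub>1 \<xi>\<^sub>2 \<xi>\<^sub>3)"


section \<open>Well-definedness\<close>

lemma lookup_root_vec: "Poly_Mapping.lookup (root_vec \<gamma>) k = of_bool (k = fst \<gamma>) - of_bool (k = snd \<gamma>)"
  by (auto simp: root_vec_def lookup_minus lookup_single when_def)

lemma root_vec_eq_iff: "root_vec \<gamma> = root_vec \<delta> + root_vec \<epsilon> \<longleftrightarrow>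
   (\<forall>k. of_bool (k = fst \<gamma>) - of_bool (k = snd \<gamma>) =
     of_bool (k = fst \<delta>) - of_bool (k = snd \<delta>) + (of_bool (k = fst \<epsilon>) - of_bool (k = snd \<epsilon>) :: int))"
  by (simp add: poly_mapping_eq_iff fun_eq_iff lookup_add lookup_root_vec)

lemma root_vec_add_iff:
  assumes "a < b" "i < j" "c < (d::nat)"
  shows "root_vec (a, b) = root_vec (i, j) + root_vec (c, d) \<longleftrightarrow>
    (a = i \<and> j = c \<and> b = d) \<or> (a = c \<and> d = i \<and> b = j)"
    (is "?L \<longleftrightarrow> ?R")
proof
  assume ?L
  then have e: "\<And>k. of_bool (k = a) - of_bool (k = b) =
     of_bool (k = i) - of_bool (k = j) + (of_bool (k = c) - of_bool (k = d) :: int)"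
    by (simp add: root_vec_eq_iff)
  have "a = i \<or> a = c" using e[of a] assms(1) by (cases "a = i"; cases "a = c") (simp_all add: of_bool_def split: if_splits)
  moreover have "j = c \<and> b = d" if "a = i"
  proof -
    have "j = c" using e[of c] assms that by (cases "j = c"; cases "c = b") (simp_all add: of_bool_def)
    then show ?thesis using e[of b] assms that by (cases "b = d") (simp_all add: of_bool_def)
  qed
  moreover have "d = i \<and> b = j" if "a = c"
  proof -
    have "d = i" using e[of i] assms that by (cases "d = i"; cases "i = b") (simp_all add: of_bool_def)
    then show ?thesis using e[of b] assms that by (cases "b = j") (simp_all add: of_bool_def)
  qed
  ultimately show ?R by blast
next
  assume ?R
  then show ?L by (auto simp: root_vec_def)
qed

lemma root_vec_inj:
  assumes "a < b" "root_vec (a, b) = root_vec (i, j)" "i < j"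
  shows "a = i \<and> b = j"
proof -
  have e: "\<And>k. of_bool (k = a) - of_bool (k = b) = (of_bool (k = i) - of_bool (k = j) :: int)"
    using assms(2) by (metis lookup_root_vec fst_conv snd_conv)
  have "a = i" using e[of a] assms by (cases "a = i") (simp_all add: of_bool_def split: if_splits)
  moreover have "b = j" using e[of b] assms by (cases "b = j") (simp_all add: of_bool_def split: if_splits)
  ultimately show ?thesis by blast
qed

lemma root_gt_iff:
  assumes "(a, b) \<in> pos_roots n" "(i, j) \<in> pos_roots n"
  shows "root_gt n (a, b) (i, j) \<longleftrightarrow> (a = i \<and> j < b) \<or> (b = j \<and> a < i)"
proof -
  have "root_gt n (a, b) (i, j) \<longleftrightarrow> (\<exists>c d. c < d \<and> d < n \<and> root_vec (a, b) = root_vec (i, j) + root_vec (c, d))"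
    by (auto simp: root_gt_def pos_roots_def image_iff diff_eq_eq algebra_simps)
  also have "\<dots> \<longleftrightarrow> (\<exists>c d. c < d \<and> d < n \<and> ((a = i \<and> j = c \<and> b = d) \<or> (a = c \<and> d = i \<and> b = j)))"
    using assms root_vec_add_iff[of a b i j] unfolding pos_roots_def by blast
  also have "\<dots> \<longleftrightarrow> (a = i \<and> j < b) \<or> (b = j \<and> a < i)"
    using assms by (auto simp: pos_roots_def)
  finally show ?thesis .
qed

lemma root_gt_height:
  "root_gt n \<gamma>' \<gamma> \<Longrightarrow> \<gamma>' \<in> pos_roots n \<Longrightarrow> \<gamma> \<in> pos_roots n
    \<Longrightarrow> snd \<gamma> - fst \<gamma> < snd \<gamma>' - fst \<gamma>'"
  by (cases \<gamma>; cases \<gamma>') (auto simp: root_gt_iff, auto simp: pos_roots_def)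

lemma roots_m_pos: "\<gamma> \<in> roots_m r \<Longrightarrow> \<gamma> \<in> pos_roots (sum_list r)"
  by (simp add: roots_m_def)

lemma ex1_base: "\<exists>!S. is_base r S"
proof -
  let ?h = "\<lambda>\<gamma>::nat \<times> nat. snd \<gamma> - fst \<gamma>"
  let ?gt = "root_gt (sum_list r)"
  define stage where "stage = rec_nat ({}::(nat \<times> nat) set)
    (\<lambda>k T. T \<union> {\<gamma> \<in> roots_m r. ?h \<gamma> = k \<and> (\<forall>\<xi>\<in>T. \<not> ?gt \<gamma> \<xi>)})"
  have s0: "stage 0 = {}" by (simp add: stage_def)
  have sS: "stage (Suc k) = stage k \<union> {\<gamma> \<in> roots_m r. ?h \<gamma> = k \<and> (\<forall>\<xi>\<in>stage k. \<not> ?gt \<gamma> \<xi>)}" for k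
    by (simp add: stage_def)
  have low: "\<gamma> \<in> stage k \<Longrightarrow> ?h \<gamma> < k \<and> \<gamma> \<in> roots_m r" for \<gamma> k
    by (induction k) (auto simp: s0 sS)
  have mono: "k \<le> l \<Longrightarrow> stage k \<subseteq> stage l" for k l
    by (induction rule: dec_induct) (auto simp: sS)
  have bk: "\<gamma> \<in> stage l \<Longrightarrow> \<gamma> \<in> stage (Suc (?h \<gamma>))" for \<gamma> l
  proof (induction l)
    case (Suc l)
    show ?case
    proof (cases "\<gamma> \<in> stage l")
      case False
      then show ?thesis using Suc.prems by (auto simp: sS)
    qed (use Suc.IH in blast)
  qed (simp add: s0)
  define S where "S = (\<Union>k. stage k)"
  have S_iff: "\<gamma> \<in> S \<longleftrightarrow> \<gamma> \<in> roots_m r \<and> (\<forall>\<xi>\<in>S. \<not> ?gt \<gamma> \<xi>)" for \<gamma>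
  proof
    assume "\<gamma> \<in> S"
    then have g: "\<gamma> \<in> stage (Suc (?h \<gamma>))" and m: "\<gamma> \<in> roots_m r"
      unfolding S_def using bk low by blast+
    have ng: "\<gamma> \<notin> stage (?h \<gamma>)" using low by blast
    have "\<not> ?gt \<gamma> \<xi>" if "\<xi> \<in> S" for \<xi>
    proof
      assume gt: "?gt \<gamma> \<xi>"
      from that have x: "\<xi> \<in> stage (Suc (?h \<xi>))" "\<xi> \<in> roots_m r"
        unfolding S_def using bk low by blast+
      have "?h \<xi> < ?h \<gamma>" using root_gt_height[OF gt] m x(2) roots_m_pos by blast
      then have "\<xi> \<in> stage (?h \<gamma>)" using mono[of "Suc (?h \<xi>)" "?h \<gamma>"] x(1) by auto
      then show False using g ng gt by (auto simp: sS)
    qed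
    with m show "\<gamma> \<in> roots_m r \<and> (\<forall>\<xi>\<in>S. \<not> ?gt \<gamma> \<xi>)" by blast
  next
    assume "\<gamma> \<in> roots_m r \<and> (\<forall>\<xi>\<in>S. \<not> ?gt \<gamma> \<xi>)"
    then have "\<gamma> \<in> stage (Suc (?h \<gamma>))" by (auto simp: sS S_def)
    then show "\<gamma> \<in> S" unfolding S_def by blast
  qed
  have B: "is_base r S"
    unfolding is_base_def using S_iff by blast
  have "T = S" if T: "is_base r T" for T
  proof -
    have "\<gamma> \<in> roots_m r \<Longrightarrow> \<gamma> \<in> T \<longleftrightarrow> \<gamma> \<in> S" for \<gamma>
    proof (induction \<gamma> rule: measure_induct_rule[of ?h])
      case (less \<gamma>)
      have IH: "\<xi> \<in> T \<longleftrightarrow> \<xi> \<in> S" if "?gt \<gamma> \<xi>" "\<xi> \<in> roots_m r" for \<xi>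
        using less.IH[of \<xi>] root_gt_height[OF that(1)] that less.prems roots_m_pos by blast
      have "\<gamma> \<in> T \<longleftrightarrow> (\<forall>\<xi>\<in>T. \<not> ?gt \<gamma> \<xi>)"
        using T less.prems unfolding is_base_def by blast
      also have "\<dots> \<longleftrightarrow> (\<forall>\<xi>\<in>S. \<not> ?gt \<gamma> \<xi>)"
        using IH T S_iff unfolding is_base_def by blast
      also have "\<dots> \<longleftrightarrow> \<gamma> \<in> S" using S_iff less.prems by blast
      finally show ?case .
    qed
    then show ?thesis using T S_iff unfolding is_base_def by blast
  qed
  with B show ?thesis by blast
qed

lemma is_base_base: "is_base r (base r)"
  unfolding base_def by (rule theI') (rule ex1_base)

lemma base_subset: "base r \<subseteq> roots_m r"
  using is_base_base unfolding is_base_def by blast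

lemma base_row_col:
  assumes "(i, j) \<in> base r" "(k, l) \<in> base r" "i = k \<or> j = l"
  shows "i = k \<and> j = l"
proof -
  have p: "(i, j) \<in> pos_roots (sum_list r)" "(k, l) \<in> pos_roots (sum_list r)"
    using assms base_subset roots_m_pos by blast+
  have "\<not> root_gt (sum_list r) (i, j) (k, l)" "\<not> root_gt (sum_list r) (k, l) (i, j)"
    using is_base_base assms unfolding is_base_def by blast+
  then show ?thesis using assms(3) by (auto simp: root_gt_iff[OF p] root_gt_iff[OF p(2,1)])
qed

lemma adm_pair_eq:
  assumes "admissible r q"
  shows "adm_pair r (pair_root q) = q"
  unfolding adm_pair_def
proof (rule the_equality)
  fix q' assume q': "admissible r q' \<and> pair_root q' = pair_root q"
  obtain i j k l i' j' k' l' where eq: "q = ((i, j), (k, l))" "q' = ((i', j'), (k', l'))"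
    by (metis prod.collapse)
  show "q' = q"
    using assms q' base_row_col[of i j r i' j'] base_row_col[of k l r k' l']
    by (auto simp: eq admissible_def pair_root_def)
qed (use assms in simp)

lemma same_block_between: "same_block r i j \<Longrightarrow> i \<le> m \<Longrightarrow> m \<le> j \<Longrightarrow> same_block r i m \<and> same_block r m j"
  unfolding same_block_def by fastforce

lemma same_block_trans:
  assumes "same_block r i j" "same_block r j k" shows "same_block r i k"
proof -
  obtain p q where p: "{i, j} \<subseteq> {sum_list (take p r) ..< sum_list (take (Suc p) r)}" "p < length r"
    and q: "{j, k} \<subseteq> {sum_list (take q r) ..< sum_list (take (Suc q) r)}" "q < length r"
    using assms unfolding same_block_def by blast
  have mono: "sum_list (take a r) \<le> sum_list (take b r)" if "a \<le> b" for a b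
    using that by (metis le_add1 sum_list_append take_add le_add_diff_inverse)
  have "p = q"
    using mono[of "Suc p" q] mono[of "Suc q" p] p q by (cases p q rule: linorder_cases) auto
  then show ?thesis using p q unfolding same_block_def by blast
qed

lemma L_poly_eq:
  assumes "(i, j) \<in> base r" "(k, l) \<in> base r" "(j, k) \<in> roots_r r"
  shows "L_poly r (j, l) = (\<Sum>m\<in>{j..k}. minor r (i, m) * minor r (m, l))"
proof -
  let ?D = "insert 0 (root_vec ` roots_r r)"
  let ?P = "{(\<beta>, \<beta>'). \<beta> \<in> roots_m r \<and> \<beta>' \<in> roots_m r \<and> (\<exists>\<alpha>\<in>?D. \<exists>\<alpha>'\<in>?D. \<alpha> + \<alpha>' = root_vec (j, k)
    \<and> root_vec \<beta> = root_vec (i, j) + \<alpha> \<and> root_vec \<beta>' = \<alpha>' + root_vec (k, l))}"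
  have q: "adm_pair r (j, l) = ((i, j), (k, l))"
    using adm_pair_eq[of r "((i, j), (k, l))"] assms by (simp add: admissible_def pair_root_def)
  have M: "(i, j) \<in> roots_m r" "(k, l) \<in> roots_m r" using assms base_subset by blast+
  then have lt: "i < j" "k < l" "l < sum_list r" and jk: "j < k" "same_block r j k"
    using assms(3) by (auto simp: roots_m_def roots_r_def pos_roots_def)
  have "?P = (\<lambda>m. ((i, m), (m, l))) ` {j..k}"
  proof (rule Set.set_eqI, rule iffI)
    fix x assume "x \<in> ?P"
    obtain a b c d where x: "x = ((a, b), (c, d))" by (metis prod.collapse)
    from \<open>x \<in> ?P\<close> obtain \<alpha> \<alpha>' where
      m: "(a, b) \<in> roots_m r" "(c, d) \<in> roots_m r" and D: "\<alpha> \<in> ?D" "\<alpha>' \<in> ?D"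
      and e: "\<alpha> + \<alpha>' = root_vec (j, k)" "root_vec (a, b) = root_vec (i, j) + \<alpha>"
        "root_vec (c, d) = \<alpha>' + root_vec (k, l)"
      unfolding x mem_Collect_eq prod.case by blast
    have ab: "a < b" "c < d" using m by (auto simp: roots_m_def pos_roots_def)
    have sb: "\<not> same_block r i j" "\<not> same_block r k l"
      using M by (auto simp: roots_m_def roots_r_def)
    show "x \<in> (\<lambda>m. ((i, m), (m, l))) ` {j..k}"
    proof (cases "\<alpha> = 0")
      case True
      then have "a = i \<and> b = j" using root_vec_inj[of a b i j] e(2) ab lt by simp
      moreover have "root_vec (c, d) = root_vec (j, k) + root_vec (k, l)" using True e by simp
      then have "c = j \<and> d = l"
        using root_vec_add_iff[of c d j k k l] ab lt jk by auto
      ultimately show ?thesis using x jk by auto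
    next
      case False
      then obtain s t where st: "\<alpha> = root_vec (s, t)" "s < t" "same_block r s t"
        using D(1) by (auto simp: roots_r_def pos_roots_def)
      have 1: "(a = i \<and> j = s \<and> b = t) \<or> (a = s \<and> t = i \<and> b = j)"
        using root_vec_add_iff[of a b i j s t] ab(1) lt(1) st(1,2) e(2) by simp
      have 2: "root_vec (j, k) = root_vec (s, t) + \<alpha>'" using e(1) st(1) by simp
      have st': "a = i \<and> s = j \<and> b = t \<and> (\<alpha>' = 0 \<and> t = k \<or> \<alpha>' = root_vec (t, k) \<and> t < k)"
      proof (cases "\<alpha>' = 0")
        case True
        then have "j = s \<and> k = t" using root_vec_inj[of j k s t] st(2) jk(1) 2 by simp
        then show ?thesis using 1 True lt(1) st(2) by auto
      next
        case False
        then obtain u v where uv: "\<alpha>' = root_vec (u, v)" "u < v"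
          using D(2) by (auto simp: roots_r_def pos_roots_def)
        have "(j = s \<and> t = u \<and> k = v) \<or> (j = u \<and> v = s \<and> k = t)"
          using root_vec_add_iff[of j k s t u v] st(2) jk(1) 2 uv by simp
        then show ?thesis using 1 uv lt(1) st(2) jk(1) by auto
      qed
      then have "\<alpha>' = 0 \<and> t = k \<or> \<alpha>' = root_vec (t, k) \<and> t < k" by blast
      then have "c = t \<and> d = l \<and> t \<le> k"
      proof
        assume "\<alpha>' = 0 \<and> t = k"
        then show ?thesis using root_vec_inj[of c d k l] e(3) ab lt by simp
      next
        assume "\<alpha>' = root_vec (t, k) \<and> t < k"
        then show ?thesis using root_vec_add_iff[of c d t k k l] e(3) ab lt by auto
      qed
      then show ?thesis using st' st(2) x by auto
    qed
  next
    fix x assume "x \<in> (\<lambda>m. ((i, m), (m, l))) ` {j..k}"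
    then obtain m where x: "x = ((i, m), (m, l))" and m: "j \<le> m" "m \<le> k" by auto
    have sb: "same_block r j m" "same_block r m k" using same_block_between jk(2) m by blast+
    have tr: "same_block r u v \<Longrightarrow> same_block r v w \<Longrightarrow> same_block r u w" for u v w
      by (rule same_block_trans)
    have sy: "same_block r u v \<Longrightarrow> same_block r v u" for u v
      by (auto simp: same_block_def)
    have "\<not> same_block r i j" "\<not> same_block r k l"
      using M by (auto simp: roots_m_def roots_r_def)
    then have "\<not> same_block r i m" "\<not> same_block r m l" using tr sy sb by blast+
    then have im: "(i, m) \<in> roots_m r" "(m, l) \<in> roots_m r"
      using lt m jk by (auto simp: roots_m_def roots_r_def pos_roots_def)
    have z: "root_vec (u, u) = 0" for u by (simp add: root_vec_def)
    have "root_vec (j, m) \<in> ?D" "root_vec (m, k) \<in> ?D"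
      using sb m lt jk z by (cases "j = m"; cases "m = k"; auto simp: roots_r_def pos_roots_def)+
    moreover have "root_vec (j, m) + root_vec (m, k) = root_vec (j, k)"
      "root_vec (i, m) = root_vec (i, j) + root_vec (j, m)"
      "root_vec (m, l) = root_vec (m, k) + root_vec (k, l)" by (simp_all add: root_vec_def)
    ultimately show "x \<in> ?P" unfolding x mem_Collect_eq prod.case using im by metis
  qed
  moreover have "inj_on (\<lambda>m. ((i, m), (m, l))) {j..k}" by (auto simp: inj_on_def)
  ultimately show ?thesis
    by (simp add: L_poly_def q Let_def sum.reindex)
qed

lemma Cst_simps: "Cst 0 = 0" "Cst 1 = 1" "Cst (a + b) = Cst a + Cst b" "Cst (a * b) = Cst a * Cst b"
  by (simp_all add: Cst_def single_add mult_single)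

lemma poly_subst_superset:
  assumes "finite A" "Poly_Mapping.keys p \<subseteq> A"
  shows "poly_subst s p = (\<Sum>m\<in>A. Cst (Poly_Mapping.lookup p m) * monom_subst s m)"
  unfolding poly_subst_def using assms
  by (intro sum.mono_neutral_left) (auto simp: in_keys_iff Cst_simps)

lemma poly_subst_add: "poly_subst s (p + q) = poly_subst s p + poly_subst s q"
proof -
  let ?A = "Poly_Mapping.keys p \<union> Poly_Mapping.keys q"
  have "Poly_Mapping.keys (p + q) \<subseteq> ?A" by (rule keys_add)
  then show ?thesis
    by (simp add: poly_subst_superset[of ?A] lookup_add Cst_simps distrib_right sum.distrib)
qed

lemma poly_subst_0: "poly_subst s 0 = 0"
  by (simp add: poly_subst_def)

lemma poly_subst_sum: "poly_subst s (sum f A) = (\<Sum>x\<in>A. poly_subst s (f x))"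
  by (induction A rule: infinite_finite_induct) (simp_all add: poly_subst_0 poly_subst_add)

lemma monom_subst_superset:
  assumes "finite A" "Poly_Mapping.keys m \<subseteq> A"
  shows "monom_subst s m = (\<Prod>v\<in>A. s v ^ Poly_Mapping.lookup m v)"
  unfolding monom_subst_def using assms
  by (intro prod.mono_neutral_left) (auto simp: in_keys_iff)

lemma monom_subst_add: "monom_subst s (m + m') = monom_subst s m * monom_subst s m'"
proof -
  let ?A = "Poly_Mapping.keys m \<union> Poly_Mapping.keys m'"
  have "Poly_Mapping.keys (m + m') \<subseteq> ?A" by (rule keys_add)
  then show ?thesis
    by (simp add: monom_subst_superset[of ?A] lookup_add power_add prod.distrib)
qed

lemma poly_subst_single: "poly_subst s (Poly_Mapping.single m c) = Cst c * monom_subst s m"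
  by (cases "c = 0") (simp_all add: poly_subst_def Cst_simps)

lemma mpol_sum_single:
  fixes p :: "'x \<Rightarrow>\<^sub>0 'y::comm_monoid_add"
  shows "p = (\<Sum>m\<in>Poly_Mapping.keys p. Poly_Mapping.single m (Poly_Mapping.lookup p m))"
  by (rule poly_mapping_eqI) (simp add: lookup_sum lookup_single when_def in_keys_iff)

lemma poly_subst_mult: "poly_subst s (p * q) = poly_subst s p * poly_subst s q"
proof -
  let ?s = "Poly_Mapping.single" and ?l = "Poly_Mapping.lookup"
  have "poly_subst s (p * q) = poly_subst s ((\<Sum>m\<in>Poly_Mapping.keys p. ?s m (?l p m)) * (\<Sum>m\<in>Poly_Mapping.keys q. ?s m (?l q m)))"
    by (simp flip: mpol_sum_single)
  also have "\<dots> = (\<Sum>m\<in>Poly_Mapping.keys p. \<Sum>m'\<in>Poly_Mapping.keys q.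
      poly_subst s (?s m (?l p m)) * poly_subst s (?s m' (?l q m')))"
    by (simp add: sum_product poly_subst_sum mult_single poly_subst_single monom_subst_add Cst_simps mult_ac)
  also have "\<dots> = poly_subst s p * poly_subst s q"
    unfolding poly_subst_single by (simp add: sum_product poly_subst_def)
  finally show ?thesis .
qed

lemma poly_subst_Cst: "poly_subst s (Cst c) = Cst c"
  by (simp add: Cst_def poly_subst_single monom_subst_def)

lemma poly_subst_Var: "poly_subst s (Var v) = s v"
  by (simp add: Var_def poly_subst_single monom_subst_def Cst_simps)

lemma poly_subst_power: "poly_subst s (p ^ k) = poly_subst s p ^ k"
  using poly_subst_Cst[of s 1] by (induction k) (simp_all add: poly_subst_mult Cst_simps)

lemma poly_subst_prod: "poly_subst s (prod f A) = (\<Prod>x\<in>A. poly_subst s (f x))"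
  using poly_subst_Cst[of s 1]
  by (induction A rule: infinite_finite_induct) (simp_all add: poly_subst_mult Cst_simps)

lemma poly_subst_comp: "poly_subst s (poly_subst t p) = poly_subst (\<lambda>v. poly_subst s (t v)) p"
  unfolding poly_subst_def[of t] poly_subst_def[of "\<lambda>v. poly_subst s (t v)"]
  by (simp add: poly_subst_sum poly_subst_mult poly_subst_Cst monom_subst_def poly_subst_prod poly_subst_power)

lemma poly_subst_id: "poly_subst Var p = p"
proof -
  have v: "Var v ^ k = Poly_Mapping.single (Poly_Mapping.single v k) 1" for v k
    by (induction k) (simp_all add: Var_def mult_single flip: single_add)
  have pr: "(\<Prod>v\<in>A. Poly_Mapping.single (f v) (1::'a)) = Poly_Mapping.single (sum f A) 1"
    for A and f :: "nat \<times> nat \<Rightarrow> (nat \<times> nat) \<Rightarrow>\<^sub>0 nat"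
    by (induction A rule: infinite_finite_induct) (simp_all add: mult_single)
  have "monom_subst Var m = Poly_Mapping.single m (1::'a)" for m
    by (simp add: monom_subst_def v pr flip: mpol_sum_single[of m])
  then show ?thesis
    by (simp add: poly_subst_def Cst_def mult_single flip: mpol_sum_single)
qed

lemma map_mat_Cst_mult:
  assumes "A \<in> carrier_mat n m" "B \<in> carrier_mat m k"
  shows "map_mat Cst (A * B) = map_mat Cst A * map_mat Cst B"
proof -
  have s: "Cst (sum f I) = (\<Sum>i\<in>I. Cst (f i))" for f :: "nat \<Rightarrow> 'a" and I
    by (induction I rule: infinite_finite_induct) (simp_all add: Cst_simps)
  show ?thesis
    using assms by (intro eq_matI) (simp_all add: scalar_prod_def s Cst_simps)
qed

lemma map_mat_Cst_one: "map_mat Cst (1\<^sub>m n) = 1\<^sub>m n"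
  by (intro eq_matI) (simp_all add: Cst_simps one_mat_def)

lemma borel_inv:
  fixes g :: "'k::field mat"
  assumes "g \<in> borel_subgroup n"
  defines "h \<equiv> inv\<^bsub>ring_mat TYPE('k) n ()\<^esub> g"
  shows "g \<in> carrier_mat n n" "h \<in> carrier_mat n n" "g * h = 1\<^sub>m n" "h * g = 1\<^sub>m n"
    "upper_triangular g" "upper_triangular h" "h \<in> borel_subgroup n"
    "inv\<^bsub>ring_mat TYPE('k) n ()\<^esub> h = g"
proof -
  interpret R: semiring "ring_mat TYPE('k) n ()" by (rule semiring_mat)
  let ?R = "ring_mat TYPE('k) n ()"
  have u: "g \<in> Units ?R" and t: "upper_triangular g" using assms by (auto simp: borel_subgroup_def)
  show g: "g \<in> carrier_mat n n" and h: "h \<in> carrier_mat n n" and gh: "g * h = 1\<^sub>m n" and hg: "h * g = 1\<^sub>m n"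
    using u R.Units_closed[OF u] R.Units_inv_closed[OF u] R.Units_r_inv[OF u] R.Units_l_inv[OF u]
    unfolding h_def by (simp_all add: ring_mat_def)
  show "upper_triangular g" by (rule t)
  show "inv\<^bsub>?R\<^esub> h = g" unfolding h_def by (rule R.Units_inv_inv[OF u])
  have d: "g $$ (i, i) \<noteq> 0" if "i < n" for i
  proof -
    have "det g * det h = 1" using det_mult[OF g h] gh by simp
    then have "det g \<noteq> 0" by auto
    moreover have "det g = prod_list (diag_mat g)" by (rule det_upper_triangular[OF t g])
    ultimately show ?thesis using that g by (force simp: diag_mat_def prod_list_zero_iff)
  qed
  have "h $$ (i, j) = 0" if "j < i" "i < n" for i j
    using that
  proof (induction "n - i" arbitrary: i rule: less_induct)
    case less
    have "0 = (g * h) $$ (i, j)" using gh less.prems by simp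
    also have "\<dots> = (\<Sum>k = 0..<n. g $$ (i, k) * h $$ (k, j))"
      using g h less.prems by (simp add: scalar_prod_def)
    also have "\<dots> = (\<Sum>k\<in>{i}. g $$ (i, k) * h $$ (k, j))"
    proof (intro sum.mono_neutral_right ballI)
      fix k assume k: "k \<in> {0..<n} - {i}"
      show "g $$ (i, k) * h $$ (k, j) = 0"
      proof (cases "k < i")
        case True
        then show ?thesis using t g less.prems by (simp add: upper_triangular_def)
      next
        case False
        then show ?thesis using less.hyps[of k] k less.prems by (cases "k = i") auto
      qed
    qed (use less.prems in auto)
    finally show ?case using d[of i] less.prems by simp
  qed
  then show th: "upper_triangular h" using h by (simp add: upper_triangular_def)
  show "h \<in> borel_subgroup n"
    using R.Units_inv_Units[OF u] th unfolding h_def borel_subgroup_def by simp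
qed

lemma mono_same_block:
  assumes "same_block r i j" "i \<le> k" "k \<le> l" "l \<le> j"
  shows "same_block r k l"
  using assms unfolding same_block_def by fastforce

lemma Ad_inv_mat_carrier:
  assumes "g \<in> borel_subgroup (sum_list r)"
  shows "Ad_inv_mat r g \<in> carrier_mat (sum_list r) (sum_list r)"
  using borel_inv(1,2)[OF assms] by (auto simp: Ad_inv_mat_def generic_mat_def intro!: mult_carrier_mat)

lemma Ad_inv_mat_outside:
  fixes g :: "'k::field mat"
  assumes g: "g \<in> borel_subgroup (sum_list r)" and ij: "(i, j) \<notin> roots_m r" "i < sum_list r" "j < sum_list r"
  shows "Ad_inv_mat r g $$ (i, j) = 0"
proof -
  define n where "n = sum_list r"
  define h where "h = inv\<^bsub>ring_mat TYPE('k) n ()\<^esub> g"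
  note b = borel_inv[OF g, folded n_def, folded h_def]
  have X: "(generic_mat r :: 'k mpol mat) \<in> carrier_mat n n" by (simp add: generic_mat_def n_def)
  have hX: "(map_mat Cst h * generic_mat r) $$ (i, l) = (\<Sum>k=0..<n. Cst (h $$ (i, k)) * (generic_mat r :: 'k mpol mat) $$ (k, l))"
    if "l < n" for l
    using that b(1,2) X ij by (auto simp: scalar_prod_def n_def intro!: sum.cong)
  have "Ad_inv_mat r g $$ (i, j) = (\<Sum>l=0..<n. (map_mat Cst h * generic_mat r) $$ (i, l) * Cst (g $$ (l, j)))"
  proof -
    define A where "A = map_mat Cst h * (generic_mat r :: 'k mpol mat)"
    have "A \<in> carrier_mat n n" using b(2) X by (auto simp: A_def)
    then show ?thesis
      unfolding Ad_inv_mat_def n_def[symmetric] h_def[symmetric] A_def[symmetric]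
      using b(1) ij by (auto simp: scalar_prod_def n_def intro!: sum.cong)
  qed
  also have "\<dots> = 0"
  proof (intro sum.neutral ballI)
    fix l assume l: "l \<in> {0..<n}"
    show "(map_mat Cst h * generic_mat r) $$ (i, l) * Cst (g $$ (l, j)) = 0"
    proof (cases "l \<le> j")
      case False
      then have "g $$ (l, j) = 0" using b(1,5) l by (simp add: upper_triangular_def)
      then show ?thesis by (simp add: Cst_simps)
    next
      case True
      have "Cst (h $$ (i, k)) * generic_mat r $$ (k, l) = 0" if k: "k < n" for k
      proof (cases "i \<le> k")
        case False
        then have "h $$ (i, k) = 0" using b(2,6) ij by (simp add: upper_triangular_def n_def)
        then show ?thesis by (simp add: Cst_simps)
      next
        case ik: True
        have "(k, l) \<notin> roots_m r"
        proof
          assume m: "(k, l) \<in> roots_m r"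
          then have "k < l" "\<not> same_block r k l" by (auto simp: roots_m_def roots_r_def pos_roots_def)
          then have "i < j" "\<not> same_block r i j"
            using ik True mono_same_block[of r i j k l] by auto
          then show False using ij by (simp add: roots_m_def roots_r_def pos_roots_def)
        qed
        then show ?thesis using k l by (simp add: generic_mat_def n_def)
      qed
      then have "(\<Sum>k=0..<n. Cst (h $$ (i, k)) * (generic_mat r :: 'k mpol mat) $$ (k, l)) = 0"
        by (intro sum.neutral) simp
      then show ?thesis using hX l by simp
    qed
  qed
  finally show ?thesis .
qed

lemma act_poly_generic:
  fixes g :: "'k::field mat"
  assumes g: "g \<in> borel_subgroup (sum_list r)"
  shows "map_mat (act_poly r g) (generic_mat r) = Ad_inv_mat r g"
proof (rule eq_matI)
  fix i j assume "i < dim_row (Ad_inv_mat r g)" "j < dim_col (Ad_inv_mat r g)"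
  then have ij: "i < sum_list r" "j < sum_list r" using Ad_inv_mat_carrier[OF g] by auto
  then show "map_mat (act_poly r g) (generic_mat r) $$ (i, j) = Ad_inv_mat r g $$ (i, j)"
    using Ad_inv_mat_outside[OF g _ ij]
    by (cases "(i, j) \<in> roots_m r") (simp_all add: generic_mat_def act_poly_def poly_subst_Var poly_subst_0)
qed (use Ad_inv_mat_carrier[OF g] in \<open>simp_all add: generic_mat_def\<close>)

lemma act_poly_hom:
  "act_poly r g (p + q) = act_poly r g p + act_poly r g q"
  "act_poly r g (p * q) = act_poly r g p * act_poly r g q"
  "act_poly r g 0 = 0" "act_poly r g (Cst c) = Cst c"
  by (simp_all add: act_poly_def poly_subst_add poly_subst_mult poly_subst_0 poly_subst_Cst)

lemma map_mat_act_mult: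
  assumes "A \<in> carrier_mat n m" "B \<in> carrier_mat m k"
  shows "map_mat (act_poly r g) (A * B) = map_mat (act_poly r g) A * map_mat (act_poly r g) B"
  using assms by (intro eq_matI) (simp_all add: scalar_prod_def act_poly_def poly_subst_sum poly_subst_mult)

lemma act_poly_inverse:
  fixes g :: "'k::field mat"
  assumes g: "g \<in> borel_subgroup (sum_list r)"
  defines "h \<equiv> inv\<^bsub>ring_mat TYPE('k) (sum_list r) ()\<^esub> g"
  shows "act_poly r g (act_poly r h p) = p"
proof -
  define n where "n = sum_list r"
  let ?X = "generic_mat r :: 'k mpol mat" and ?C = "map_mat Cst :: 'k mat \<Rightarrow> 'k mpol mat"
  note b = borel_inv[OF g, folded h_def]
  have X: "?X \<in> carrier_mat n n" by (simp add: generic_mat_def n_def)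
  have c: "?C h \<in> carrier_mat n n" "?C g \<in> carrier_mat n n" using b by (auto simp: n_def)
  have fix_C: "map_mat (act_poly r g) (?C A) = ?C A" for A by (intro eq_matI) (simp_all add: act_poly_hom)
  have one: "?C g * ?C h = 1\<^sub>m n"
    by (simp only: n_def map_mat_Cst_one b(3) flip: map_mat_Cst_mult[OF b(1,2)])
  have "map_mat (act_poly r g) (Ad_inv_mat r h) = ?C g * (?C h * ?X * ?C g) * ?C h"
    using act_poly_generic[OF g] X c
    unfolding Ad_inv_mat_def b(8) h_def[symmetric]
    by (simp add: map_mat_act_mult[of _ n n _ n] fix_C assoc_mult_mat[of _ n n _ n _ n])
  also have "\<dots> = (?C g * ?C h) * ?X * (?C g * ?C h)"
    using X c by (simp add: assoc_mult_mat[of _ n n _ n _ n])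
  also have "\<dots> = ?X" using X by (simp add: one)
  finally have e: "map_mat (act_poly r g) (Ad_inv_mat r h) = ?X" .
  have "act_poly r g (if \<gamma> \<in> roots_m r then Ad_inv_mat r h $$ \<gamma> else Var \<gamma>) = Var \<gamma>" for \<gamma>
  proof (cases "\<gamma> \<in> roots_m r")
    case True
    obtain i j where \<gamma>: "\<gamma> = (i, j)" by fastforce
    then have ij: "i < n" "j < n" using True by (auto simp: roots_m_def pos_roots_def n_def)
    have "act_poly r g (Ad_inv_mat r h $$ \<gamma>) = map_mat (act_poly r g) (Ad_inv_mat r h) $$ \<gamma>"
      using Ad_inv_mat_carrier[OF b(7)] ij by (simp add: \<gamma> n_def)
    also have "\<dots> = Var \<gamma>" using True ij by (simp only: e) (simp add: generic_mat_def \<gamma> n_def)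
    finally show ?thesis using True by simp
  next
    case False
    then show ?thesis by (simp add: act_poly_def poly_subst_Var)
  qed
  then have "(\<lambda>\<gamma>. act_poly r g (if \<gamma> \<in> roots_m r then Ad_inv_mat r h $$ \<gamma> else Var \<gamma>)) = Var" by blast
  then have "act_poly r g (act_poly r h p) = poly_subst Var p"
    unfolding act_poly_def[of r h] unfolding act_poly_def poly_subst_comp by simp
  then show ?thesis by (simp add: poly_subst_id)
qed

lemma inj_act_poly:
  assumes "g \<in> borel_subgroup (sum_list r)"
  shows "inj (act_poly r g)"
  by (rule inj_on_inverseI[where g = "act_poly r (inv\<^bsub>ring_mat TYPE('a) (sum_list r) ()\<^esub> g)"])
    (use act_poly_inverse[OF borel_inv(7)[OF assms]] borel_inv(8)[OF assms] in simp)

lemma fract_ext_Fract: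
  assumes "\<And>p q. \<sigma> (p * q) = \<sigma> p * \<sigma> q" "inj \<sigma>" "\<sigma> 0 = 0" "q \<noteq> 0"
  shows "fract_ext \<sigma> (Fract p q) = Fract (\<sigma> p) (\<sigma> q)"
  unfolding fract_ext_def
proof (rule the_equality)
  show "\<exists>p' q'. q' \<noteq> 0 \<and> Fract p q = Fract p' q' \<and> Fract (\<sigma> p) (\<sigma> q) = Fract (\<sigma> p') (\<sigma> q')"
    using assms(4) by blast
next
  fix w assume "\<exists>p' q'. q' \<noteq> 0 \<and> Fract p q = Fract p' q' \<and> w = Fract (\<sigma> p') (\<sigma> q')"
  then obtain p' q' where *: "q' \<noteq> 0" "Fract p q = Fract p' q'" "w = Fract (\<sigma> p') (\<sigma> q')" by blast
  have nz: "\<sigma> q \<noteq> 0" "\<sigma> q' \<noteq> 0"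
    using assms(2,3,4) *(1) by (metis injD)+
  have "p * q' = p' * q" using * assms(4) by (simp add: eq_fract)
  then have "\<sigma> p * \<sigma> q' = \<sigma> p' * \<sigma> q" by (metis assms(1))
  then show "w = Fract (\<sigma> p) (\<sigma> q)" using nz *(3) by (simp add: eq_fract)
qed

lemma act_rat_Fract:
  assumes "g \<in> borel_subgroup (sum_list r)" "q \<noteq> 0"
  shows "act_rat r g (Fract p q) = Fract (act_poly r g p) (act_poly r g q)"
  unfolding act_rat_def
  by (rule fract_ext_Fract) (use assms inj_act_poly act_poly_hom in auto)

end

theory Submission
  imports Defs
begin

text \<open>
  Numerator and denominator of the rational function are products of polynomials each of which is
  multiplied by a scalar (its weight) by every element of \<open>B\<close>, and the two weights agree.

  The reason for the first point is the shape of the base \<open>S\<close>. For \<open>(i, j) \<in> S\<close> the minor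
  \<open>M\<^sub>i\<^sub>j\<close> is taken over all rows and columns in which the lower left corner of \<open>\<bbbX>\<close> at \<open>(i, j)\<close>
  is not zero (lemmas \<open>base_below_rows\<close> and \<open>base_below_cols\<close>). Conjugation by an upper triangular matrix
  adds lower rows to higher ones and left columns to right ones, so it brings nothing new into such a
  corner. When \<open>j\<close> is replaced by a later column \<open>m\<close> of the same diagonal block, the other rows and
  columns of the minor remain the same, because inside a block the base is arranged
  antitonically; only the last column is now replaced by a combination of the columns \<open>j, \<dots>, m\<close>.
  Hence, up to a common scalar, \<open>g\<close> multiplies the row vector \<open>(M\<^sub>i\<^sub>m)\<close> by a diagonal block of \<open>g\<close>
  (\<open>act_minor_col\<close>), and likewise it multiplies the column vector \<open>(M\<^sub>m\<^sub>l)\<close> for \<open>(k, l) \<in> S\<close> by a diagonal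
  block of \<open>g\<^sup>-\<^sup>1\<close> (\<open>act_minor_row\<close>). In \<open>L\<^sub>j\<^sub>l = \<Sum> M\<^sub>i\<^sub>m M\<^sub>m\<^sub>l\<close> the two blocks cancel (\<open>act_L_poly\<close>).

  The weight of \<open>L\<^sub>j\<^sub>l\<close> that is left is a product \<open>u(j) v(l)\<close>. Therefore \<open>L\<^sub>i\<^sub>b L\<^sub>j\<^sub>a\<close> and \<open>L\<^sub>i\<^sub>a L\<^sub>j\<^sub>b\<close>
  have the same weight \<open>u(i) u(j) v(a) v(b)\<close>. If \<open>(j, b)\<close> lies in \<open>S\<close>, then \<open>L\<^sub>j\<^sub>b\<close> gives way to the
  product of the minor of the base root in column \<open>j\<close>, of weight \<open>u(j) g\<^sub>j\<^sub>j\<close>, and the minor of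
  \<open>(j, b)\<close>, of weight \<open>g\<^sub>j\<^sub>j\<^sup>-\<^sup>1 v(b)\<close>, and the weight is again the same.

  The denominator is nonzero because setting suitable variables to \<open>1\<close> and the others to \<open>0\<close> turns the
  minors of base roots into determinants of permutation matrices, and all but one term of
  each \<open>L\<^sub>j\<^sub>l\<close> into \<open>0\<close>.
\<close>

section \<open>Minors of products with sparse factors\<close>

lemma bij_betw_pick: "finite K \<Longrightarrow> bij_betw (pick K) {..<card K} K"
proof (rule bij_betwI[where g = "\<lambda>x. card {a \<in> K. a < x}"])
  assume "finite K"
  show "(\<lambda>x. card {a \<in> K. a < x}) \<in> K \<rightarrow> {..<card K}"
  proof
    fix x assume "x \<in> K"
    then have "{a \<in> K. a < x} \<subset> K" by blast
    then show "card {a \<in> K. a < x} \<in> {..<card K}"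
      using psubset_card_mono[OF \<open>finite K\<close>] by simp
  qed
qed (auto simp: pick_in_set pick_card_in_set card_pick)

lemma submatrix_eq_mat:
  assumes "A \<in> carrier_mat n m" "I \<subseteq> {..<n}" "J \<subseteq> {..<m}"
  shows "submatrix A I J = mat (card I) (card J) (\<lambda>(u, v). A $$ (pick I u, pick J v))"
proof -
  have "{i. i < n \<and> i \<in> I} = I" "{j. j < m \<and> j \<in> J} = J" using assms by auto
  then show ?thesis using assms(1) by (simp add: submatrix_def)
qed

lemma submatrix_carrier:
  assumes "A \<in> carrier_mat n m" "I \<subseteq> {..<n}" "J \<subseteq> {..<m}"
  shows "submatrix A I J \<in> carrier_mat (card I) (card J)"
  using submatrix_eq_mat[OF assms] by simp

lemma transpose_submatrix:
  assumes "A \<in> carrier_mat n m" "I \<subseteq> {..<n}" "J \<subseteq> {..<m}"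
  shows "transpose_mat (submatrix A I J) = submatrix (transpose_mat A) J I"
proof -
  have A: "transpose_mat A \<in> carrier_mat m n" using assms by simp
  show ?thesis
    unfolding submatrix_eq_mat[OF assms] submatrix_eq_mat[OF A assms(3,2)]
  proof (rule eq_matI)
    fix u v assume "u < dim_row (mat (card J) (card I) (\<lambda>(u, v). transpose_mat A $$ (pick J u, pick I v)))"
      "v < dim_col (mat (card J) (card I) (\<lambda>(u, v). transpose_mat A $$ (pick J u, pick I v)))"
    then have uv: "u < card J" "v < card I" by auto
    then have "pick J u < m" "pick I v < n" using assms pick_in_set by blast+
    then show "transpose_mat (mat (card I) (card J) (\<lambda>(u, v). A $$ (pick I u, pick J v))) $$ (u, v)
      = mat (card J) (card I) (\<lambda>(u, v). transpose_mat A $$ (pick J u, pick I v)) $$ (u, v)"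
      using uv assms(1) by simp
  qed auto
qed

text \<open>
  Only an index set that carries all nonzero products matters, so a submatrix of a product is a
  product of submatrices as soon as the factors have enough zeros.
\<close>

lemma submatrix_mult:
  fixes A B :: "'a::comm_ring_1 mat"
  assumes A: "A \<in> carrier_mat n n" and B: "B \<in> carrier_mat n n"
    and I: "I \<subseteq> {..<n}" and K: "K \<subseteq> {..<n}" and J: "J \<subseteq> {..<n}"
    and z: "\<And>p k q. p \<in> I \<Longrightarrow> k < n \<Longrightarrow> k \<notin> K \<Longrightarrow> q \<in> J \<Longrightarrow> A $$ (p, k) * B $$ (k, q) = 0"
  shows "submatrix (A * B) I J = submatrix A I K * submatrix B K J"
proof -
  have AB: "A * B \<in> carrier_mat n n" using A B by simp
  have fK: "finite K" using K finite_subset by blast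
  show ?thesis
    unfolding submatrix_eq_mat[OF AB I J] submatrix_eq_mat[OF A I K] submatrix_eq_mat[OF B K J]
  proof (rule eq_matI, goal_cases)
    case (1 u v)
    then have uv: "u < card I" "v < card J" by auto
    then have p: "pick I u \<in> I" "pick J v \<in> J" using pick_in_set by blast+
    then have pn: "pick I u < n" "pick J v < n" using I J by auto
    have "(A * B) $$ (pick I u, pick J v) = (\<Sum>k<n. A $$ (pick I u, k) * B $$ (k, pick J v))"
      using A B pn by (simp add: scalar_prod_def atLeast0LessThan)
    also have "\<dots> = (\<Sum>k\<in>K. A $$ (pick I u, k) * B $$ (k, pick J v))"
      by (rule sum.mono_neutral_right) (use K z p in auto)
    also have "\<dots> = (\<Sum>w<card K. A $$ (pick I u, pick K w) * B $$ (pick K w, pick J v))"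
      by (rule sum.reindex_bij_betw[OF bij_betw_pick[OF fK], symmetric])
    finally show ?case using uv by (simp add: scalar_prod_def atLeast0LessThan)
  qed auto
qed

lemma det_submatrix_upper_triangular:
  fixes A :: "'a::comm_ring_1 mat"
  assumes A: "A \<in> carrier_mat n n" and I: "I \<subseteq> {..<n}" and t: "upper_triangular A"
  shows "det (submatrix A I I) = (\<Prod>p\<in>I. A $$ (p, p))"
proof -
  have fI: "finite I" using I finite_subset by blast
  have c: "submatrix A I I \<in> carrier_mat (card I) (card I)" by (rule submatrix_carrier[OF A I I])
  have e: "submatrix A I I $$ (u, v) = A $$ (pick I u, pick I v)" if "u < card I" "v < card I" for u v
    using that submatrix_eq_mat[OF A I I] by simp
  have "upper_triangular (submatrix A I I)"
  proof
    fix u v assume uv: "v < u" "u < dim_row (submatrix A I I)"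
    then have uv: "v < u" "u < card I" using c by auto
    then have "pick I v < pick I u" "pick I u < n" using I pick_mono[of u I v] pick_in_set[of u I] by auto
    then show "submatrix A I I $$ (u, v) = 0" using e uv t A by (simp add: upper_triangularD)
  qed
  from det_upper_triangular[OF this c]
  have "det (submatrix A I I) = (\<Prod>u<card I. A $$ (pick I u, pick I u))"
    using c e by (simp add: prod_list_diag_prod atLeast0LessThan)
  also have "\<dots> = (\<Prod>p\<in>I. A $$ (p, p))"
    by (rule prod.reindex_bij_betw[OF bij_betw_pick[OF fI]])
  finally show ?thesis .
qed

lemma pick_insert:
  assumes "m \<notin> C"
  shows "pick (insert m C) (card {c \<in> C. c < m}) = m"
proof -
  have "{a \<in> insert m C. a < m} = {c \<in> C. c < m}" by auto
  then show ?thesis using pick_card_in_set[of m "insert m C"] by simp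
qed

text \<open>
  Exchanging the element \<open>m\<close> for \<open>m'\<close> between the same two neighbours leaves the enumeration of the
  other elements alone. Hence minors that differ in one column only, with no other chosen column in
  between, differ in one column at the same position, and no signs appear when they are added.
\<close>

lemma pick_insert_cong:
  assumes fin: "finite C" and m: "m \<notin> C" "m' \<notin> C"
    and eq: "{c \<in> C. c < m} = {c \<in> C. c < m'}"
    and u: "u < Suc (card C)" "u \<noteq> card {c \<in> C. c < m}"
  shows "pick (insert m C) u = pick (insert m' C) u" "pick (insert m C) u \<in> C"
proof -
  have cu: "u < card (insert m C)" using fin m u by simp
  let ?x = "pick (insert m C) u"
  have x: "?x \<in> insert m C" "card {a \<in> insert m C. a < ?x} = u"
    using pick_in_set card_pick cu by blast+
  have "?x \<noteq> m"
  proof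
    assume "?x = m"
    then have "{a \<in> insert m C. a < ?x} = {c \<in> C. c < m}" by auto
    then show False using x u by simp
  qed
  then show xC: "?x \<in> C" using x by simp
  have iff: "m < ?x \<longleftrightarrow> m' < ?x" 
  proof -
    have "?x < m \<longleftrightarrow> ?x < m'" using eq xC by blast
    moreover have "?x \<noteq> m" "?x \<noteq> m'" using xC m by auto
    ultimately show ?thesis by linarith
  qed
  have "card {a \<in> insert m' C. a < ?x} = card {a \<in> insert m C. a < ?x}"
  proof (cases "m < ?x")
    case True
    have "{a \<in> insert m' C. a < ?x} = insert m' {c \<in> C. c < ?x}" using iff True by auto
    moreover have "{a \<in> insert m C. a < ?x} = insert m {c \<in> C. c < ?x}" using True by auto
    ultimately show ?thesis using fin m by simp
  next
    case False
    have "{a \<in> insert m' C. a < ?x} = {a \<in> insert m C. a < ?x}" using iff False by auto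
    then show ?thesis by simp
  qed
  then have "card {a \<in> insert m' C. a < ?x} = u" using x by simp
  then show "?x = pick (insert m' C) u" using pick_card_in_set[of ?x "insert m' C"] xC by auto
qed

lemma det_column_sum:
  fixes F :: "'b \<Rightarrow> 'a::comm_ring_1 mat"
  assumes c: "A \<in> carrier_mat k k" "\<And>t. t \<in> T \<Longrightarrow> F t \<in> carrier_mat k k" and w: "w < k"
    and same: "\<And>t u v. t \<in> T \<Longrightarrow> u < k \<Longrightarrow> v < k \<Longrightarrow> v \<noteq> w \<Longrightarrow> F t $$ (u, v) = A $$ (u, v)"
    and col: "\<And>u. u < k \<Longrightarrow> A $$ (u, w) = (\<Sum>t\<in>T. c t * F t $$ (u, w))"
  shows "det A = (\<Sum>t\<in>T. c t * det (F t))"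
proof -
  have cof: "cofactor (F t) u w = cofactor A u w" if "t \<in> T" "u < k" for t u
  proof -
    have "mat_delete (F t) u w = mat_delete A u w"
      unfolding mat_delete_def using c that w same
      by (intro eq_matI) (auto simp: c(2)[THEN carrier_matD(1)] c(2)[THEN carrier_matD(2)])
    then show ?thesis by (simp add: cofactor_def)
  qed
  have "det A = (\<Sum>u<k. A $$ (u, w) * cofactor A u w)" by (rule laplace_expansion_column[OF c(1) w])
  also have "\<dots> = (\<Sum>u<k. \<Sum>t\<in>T. c t * (F t $$ (u, w) * cofactor (F t) u w))"
    by (intro sum.cong refl) (simp add: col cof sum_distrib_right mult.assoc)
  also have "\<dots> = (\<Sum>t\<in>T. c t * (\<Sum>u<k. F t $$ (u, w) * cofactor (F t) u w))"
    by (subst sum.swap) (simp add: sum_distrib_left)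
  also have "\<dots> = (\<Sum>t\<in>T. c t * det (F t))"
    by (intro sum.cong refl) (simp add: laplace_expansion_column[OF c(2) w])
  finally show ?thesis .
qed

text \<open>
  The columns \<open>C\<close> of \<open>X * Q\<close> are triangular combinations of the columns \<open>C\<close> of \<open>X\<close>, which contributes
  the diagonal product. Column \<open>m\<close> combines columns of \<open>T\<close> and of \<open>C\<close>; the latter can be removed by
  column operations, and linearity in column \<open>m\<close> gives the sum over \<open>T\<close>. The matrix \<open>Q\<close> may be
  triangular in either direction because the statement is also applied to transposed matrices.
\<close>

lemma det_submatrix_mult_insert_col:
  fixes X Q :: "'a::comm_ring_1 mat"
  assumes X: "X \<in> carrier_mat n n" and Q: "Q \<in> carrier_mat n n"
    and tri: "(\<forall>a<n. \<forall>b<a. Q $$ (a, b) = 0) \<or> (\<forall>b<n. \<forall>a<b. Q $$ (a, b) = 0)"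
    and I: "I \<subseteq> {..<n}" and C: "C \<subseteq> {..<n}" and T: "T \<subseteq> {..<n}" and cI: "card I = Suc (card C)"
    and disj: "T \<inter> C = {}" and mT: "m \<in> T"
    and pos: "\<And>t. t \<in> T \<Longrightarrow> {c \<in> C. c < t} = {c \<in> C. c < m}"
    and zC: "\<And>p q c. p \<in> I \<Longrightarrow> q < n \<Longrightarrow> q \<notin> C \<Longrightarrow> c \<in> C \<Longrightarrow> X $$ (p, q) * Q $$ (q, c) = 0"
    and zm: "\<And>p q. p \<in> I \<Longrightarrow> q < n \<Longrightarrow> q \<notin> C \<Longrightarrow> q \<notin> T \<Longrightarrow> X $$ (p, q) * Q $$ (q, m) = 0"
  shows "det (submatrix (X * Q) I (insert m C)) =
    (\<Prod>c\<in>C. Q $$ (c, c)) * (\<Sum>t\<in>T. Q $$ (t, m) * det (submatrix X I (insert t C)))"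
proof -
  define k where "k = Suc (card C)"
  define w where "w = card {c \<in> C. c < m}"
  define J where "J = insert m C"
  have fC: "finite C" and fT: "finite T" using C T finite_subset by blast+
  have mC: "m \<notin> C" and tC: "\<And>t. t \<in> T \<Longrightarrow> t \<notin> C" using disj mT by auto
  have mn: "m < n" using T mT by auto
  have cJ: "card J = k" "finite J" and JS: "J \<subseteq> {..<n}" using fC mC mn C by (auto simp: J_def k_def)
  have wk: "w < k" unfolding w_def k_def using card_mono[OF fC, of "{c \<in> C. c < m}"] by auto
  have Jw: "pick J w = m" unfolding J_def w_def by (rule pick_insert[OF mC])
  have JC: "pick J u \<in> C" if "u < k" "u \<noteq> w" for u
    using pick_insert_cong(2)[OF fC mC mC refl] that unfolding J_def k_def w_def by blast
  have JT: "pick (insert t C) u = (if u = w then t else pick J u)" if "t \<in> T" "u < k" for t u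
    using pick_insert[OF tC[OF that(1)]] pick_insert_cong(1)[OF fC mC tC[OF that(1)] pos[OF that(1), symmetric]]
      pos[OF that(1)] that
    unfolding J_def k_def w_def by auto
  have In: "pick I u < n" "pick I u \<in> I" if "u < k" for u
    using that pick_in_set[of u I] I cI unfolding k_def by auto
  have Jn: "pick J u < n" if "u < k" for u
    using that pick_in_set[of u J] JS cJ by auto
  have XQ: "X * Q \<in> carrier_mat n n" using X Q by simp
  have tn: "insert t C \<subseteq> {..<n}" "card (insert t C) = k" if "t \<in> T" for t
    using that T C tC[OF that] fC by (auto simp: k_def)
  have sub: "submatrix X I (insert t C) = mat k k (\<lambda>(u, v). X $$ (pick I u, if v = w then t else pick J v))"
    if "t \<in> T" for t
    unfolding submatrix_eq_mat[OF X I tn(1)[OF that]] tn(2)[OF that] cI k_def[symmetric]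
    using JT[OF that] by (intro eq_matI) auto
  (* N has the columns C of X and, at position w, the T-part of column m of X * Q;
     G does the column operations, including the C-part of column m. *)
  define N where "N = mat k k (\<lambda>(u, v). if v = w then \<Sum>t\<in>T. X $$ (pick I u, t) * Q $$ (t, m) else X $$ (pick I u, pick J v))"
  define G where "G = mat k k (\<lambda>(u, v). if u = w then of_bool (v = w) else Q $$ (pick J u, pick J v))"
  have "submatrix (X * Q) I J = N * G"
    unfolding submatrix_eq_mat[OF XQ I JS] cI cJ k_def[symmetric]
  proof (rule eq_matI, goal_cases)
    case (1 u v)
    then have uv: "u < k" "v < k" by (auto simp: N_def G_def)
    let ?f = "\<lambda>q. X $$ (pick I u, q) * Q $$ (q, pick J v)"
    have CJ: "(\<Sum>q\<in>C. ?f q) = (\<Sum>y\<in>{..<k} - {w}. N $$ (u, y) * G $$ (y, v))"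
    proof -
      have "(\<Sum>q\<in>J. ?f q) = (\<Sum>y<k. ?f (pick J y))"
        using sum.reindex_bij_betw[OF bij_betw_pick[OF cJ(2)], of ?f] cJ(1) by simp
      then have "?f m + (\<Sum>q\<in>C. ?f q) = ?f m + (\<Sum>y\<in>{..<k} - {w}. ?f (pick J y))"
        using fC mC wk Jw unfolding J_def by (simp add: sum.remove[of "{..<k}" w])
      then show ?thesis using uv by (simp add: N_def G_def)
    qed
    have "(X * Q) $$ (pick I u, pick J v) = (\<Sum>q<n. ?f q)"
      using X Q In Jn uv by (simp add: scalar_prod_def atLeast0LessThan)
    also have "\<dots> = (\<Sum>y<k. N $$ (u, y) * G $$ (y, v))"
    proof (cases "v = w")
      case True
      have "(\<Sum>q<n. ?f q) = (\<Sum>q\<in>T \<union> C. ?f q)"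
        by (rule sum.mono_neutral_right) (use T C zm In uv True Jw in auto)
      also have "\<dots> = (\<Sum>q\<in>T. ?f q) + (\<Sum>q\<in>C. ?f q)"
        using fT fC disj by (simp add: sum.union_disjoint)
      finally show ?thesis using CJ uv True wk Jw
        by (simp add: sum.remove[of "{..<k}" w] N_def G_def)
    next
      case False
      have "(\<Sum>q<n. ?f q) = (\<Sum>q\<in>C. ?f q)"
        by (rule sum.mono_neutral_right) (use C zC In JC uv False in auto)
      then show ?thesis using CJ uv False wk by (simp add: sum.remove[of "{..<k}" w] G_def)
    qed
    finally show ?case using uv by (simp add: N_def G_def scalar_prod_def atLeast0LessThan)
  qed (auto simp: N_def G_def)
  moreover have "N \<in> carrier_mat k k" "G \<in> carrier_mat k k" by (auto simp: N_def G_def)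
  ultimately have "det (submatrix (X * Q) I J) = det N * det G" by (simp add: det_mult)
  moreover have "det N = (\<Sum>t\<in>T. Q $$ (t, m) * det (submatrix X I (insert t C)))"
    by (rule det_column_sum[of _ k _ _ w]) (auto simp: N_def sub wk mult_ac intro!: sum.cong)
  moreover have "det G = (\<Prod>c\<in>C. Q $$ (c, c))"
  proof -
    have G: "G \<in> carrier_mat k k" by (simp add: G_def)
    from tri have "det G = prod_list (diag_mat G)"
    proof
      assume t: "\<forall>a<n. \<forall>b<a. Q $$ (a, b) = 0"
      have "G $$ (u, v) = 0" if "v < u" "u < k" for u v
        using that t pick_mono[of u J v] Jn[of u] cJ by (auto simp: G_def)
      then have "upper_triangular G" using G by (auto intro!: upper_triangularI)
      then show ?thesis using det_upper_triangular G by blast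
    next
      assume t: "\<forall>b<n. \<forall>a<b. Q $$ (a, b) = 0"
      have "G $$ (u, v) = 0" if "u < v" "v < k" for u v
        using that t pick_mono[of v J u] Jn[of v] cJ by (auto simp: G_def)
      then show ?thesis using det_lower_triangular G by blast
    qed
    also have "\<dots> = (\<Prod>u<k. G $$ (u, u))" using G by (simp add: prod_list_diag_prod atLeast0LessThan)
    also have "\<dots> = (\<Prod>u\<in>{..<k} - {w}. Q $$ (pick J u, pick J u))"
      using wk by (simp add: prod.remove[of "{..<k}" w] G_def)
    also have "\<dots> = (\<Prod>c\<in>C. Q $$ (c, c))"
    proof (rule prod.reindex_bij_betw)
      have "bij_betw (pick J) ({..<k} - {w}) (J - {m})"
        using bij_betw_DiffI[OF bij_betw_pick[OF cJ(2)], of "{w}" "{m}"] wk Jw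
        unfolding cJ(1) by (simp add: J_def)
      then show "bij_betw (pick J) ({..<k} - {w}) C" using mC by (simp add: J_def)
    qed
    finally show ?thesis .
  qed
  ultimately show ?thesis by (simp add: J_def mult.commute)
qed

lemma det_submatrix_mult_insert_row:
  fixes X P :: "'a::comm_ring_1 mat"
  assumes X: "X \<in> carrier_mat n n" and P: "P \<in> carrier_mat n n" and tri: "upper_triangular P"
    and J: "J \<subseteq> {..<n}" and R: "R \<subseteq> {..<n}" and T: "T \<subseteq> {..<n}" and cJ: "card J = Suc (card R)"
    and disj: "T \<inter> R = {}" and mT: "m \<in> T"
    and pos: "\<And>t. t \<in> T \<Longrightarrow> {p \<in> R. p < t} = {p \<in> R. p < m}"
    and zR: "\<And>a p q. q \<in> J \<Longrightarrow> p < n \<Longrightarrow> p \<notin> R \<Longrightarrow> a \<in> R \<Longrightarrow> P $$ (a, p) * X $$ (p, q) = 0"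
    and zm: "\<And>p q. q \<in> J \<Longrightarrow> p < n \<Longrightarrow> p \<notin> R \<Longrightarrow> p \<notin> T \<Longrightarrow> P $$ (m, p) * X $$ (p, q) = 0"
  shows "det (submatrix (P * X) (insert m R) J) =
    (\<Prod>p\<in>R. P $$ (p, p)) * (\<Sum>t\<in>T. P $$ (m, t) * det (submatrix X (insert t R) J))"
proof -
  let ?t = transpose_mat
  have tr: "det (submatrix A (insert t R) J) = det (submatrix (?t A) J (insert t R))"
    if "A \<in> carrier_mat n n" "t \<in> T" for A :: "'a mat" and t
  proof -
    have s: "insert t R \<subseteq> {..<n}" "card (insert t R) = card J"
      using R T disj[THEN equals0D, of t] that(2) cJ finite_subset[OF R] by auto
    show ?thesis
      using det_transpose[of "submatrix A (insert t R) J" "card J"] submatrix_carrier[OF that(1) s(1) J] s(2)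
        transpose_submatrix[OF that(1) s(1) J] by simp
  qed
  have PX: "P * X \<in> carrier_mat n n" "?t X \<in> carrier_mat n n" "?t P \<in> carrier_mat n n" using P X by simp_all
  have Jn: "q < n" if "q \<in> J" for q using J that by auto
  have Rn: "q < n" if "q \<in> R" for q using R that by auto
  have Tn: "q < n" if "q \<in> T" for q using T that by auto
  have "det (submatrix (P * X) (insert m R) J) = det (submatrix (?t X * ?t P) J (insert m R))"
    unfolding tr[OF PX(1) mT] transpose_mult[OF P X] ..
  also have "\<dots> = (\<Prod>p\<in>R. ?t P $$ (p, p)) * (\<Sum>t\<in>T. ?t P $$ (t, m) * det (submatrix (?t X) J (insert t R)))"
  proof (rule det_submatrix_mult_insert_col[OF PX(2,3) _ J R T cJ disj mT pos])
    show "(\<forall>a<n. \<forall>b<a. ?t P $$ (a, b) = 0) \<or> (\<forall>b<n. \<forall>a<b. ?t P $$ (a, b) = 0)"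
      using tri P by (auto simp: upper_triangular_def)
  next
    fix q p a assume "q \<in> J" "p < n" "p \<notin> R" "a \<in> R"
    then show "?t X $$ (q, p) * ?t P $$ (p, a) = 0"
      using zR[of q p a] Jn Rn P X by (simp add: mult.commute)
  next
    fix q p assume "q \<in> J" "p < n" "p \<notin> R" "p \<notin> T"
    then show "?t X $$ (q, p) * ?t P $$ (p, m) = 0"
      using zm[of q p] Jn Tn[OF mT] P X by (simp add: mult.commute)
  qed
  also have "\<dots> = (\<Prod>p\<in>R. P $$ (p, p)) * (\<Sum>t\<in>T. P $$ (m, t) * det (submatrix X (insert t R) J))"
  proof -
    have "(\<Prod>p\<in>R. ?t P $$ (p, p)) = (\<Prod>p\<in>R. P $$ (p, p))"
      by (intro prod.cong refl) (use P Rn in simp)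
    moreover have "(\<Sum>t\<in>T. ?t P $$ (t, m) * det (submatrix (?t X) J (insert t R))) =
      (\<Sum>t\<in>T. P $$ (m, t) * det (submatrix X (insert t R) J))"
      by (intro sum.cong refl) (use P Tn mT tr[OF X] in simp)
    ultimately show ?thesis by simp
  qed
  finally show ?thesis .
qed

section \<open>The shape of the base\<close>

lemma roots_m_iff: "(p, q) \<in> roots_m r \<longleftrightarrow> p < q \<and> q < sum_list r \<and> \<not> same_block r p q"
  by (auto simp: roots_m_def roots_r_def pos_roots_def)

lemma roots_m_mono:
  assumes "(p, q) \<in> roots_m r" "p' \<le> p" "q \<le> q'" "q' < sum_list r"
  shows "(p', q') \<in> roots_m r"
  using assms mono_same_block[of r p' q' p q] by (auto simp: roots_m_iff)

lemma roots_m_col_cong: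
  assumes "same_block r j m" "j \<le> m" "m < sum_list r"
  shows "(p, j) \<in> roots_m r \<longleftrightarrow> (p, m) \<in> roots_m r"
proof
  assume m: "(p, m) \<in> roots_m r"
  have "\<not> same_block r p j"
    using m assms(1) same_block_trans[of r p j m] by (auto simp: roots_m_iff)
  moreover have "p < j"
    using m assms(1) same_block_between[of r j m p] by (force simp: roots_m_iff)
  ultimately show "(p, j) \<in> roots_m r" using assms by (simp add: roots_m_iff)
qed (use assms roots_m_mono in blast)

lemma roots_m_row_cong:
  assumes "same_block r m k" "m \<le> k"
  shows "(m, q) \<in> roots_m r \<longleftrightarrow> (k, q) \<in> roots_m r"
proof
  assume m: "(m, q) \<in> roots_m r"
  have "\<not> same_block r k q"
    using m assms(1) same_block_trans[of r m k q] by (auto simp: roots_m_iff)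
  moreover have "k < q"
    using m assms(1) same_block_between[of r m k q] by (force simp: roots_m_iff)
  ultimately show "(k, q) \<in> roots_m r" using m by (simp add: roots_m_iff)
next
  assume "(k, q) \<in> roots_m r"
  then show "(m, q) \<in> roots_m r" using roots_m_mono[of k q r m q] assms(2) by (simp add: roots_m_iff)
qed

text \<open>
  A root \<open>\<gamma>\<close> exceeds a base root by a positive root exactly when it lies to the right of it in the same
  row or above it in the same column, so the existence half of the definition of the base reads as
  follows.
\<close>

lemma base_dominates:
  assumes "(a, b) \<in> roots_m r"
  obtains "(a, b) \<in> base r" | c where "c < b" "(a, c) \<in> base r" | d where "a < d" "(d, b) \<in> base r"
proof (cases "(a, b) \<in> base r")
  case False
  have "\<forall>\<gamma>\<in>roots_m r - base r. \<exists>\<xi>\<in>base r. root_gt (sum_list r) \<gamma> \<xi>"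
    using is_base_base[of r] by (simp add: is_base_def)
  then have "\<exists>\<xi>\<in>base r. root_gt (sum_list r) (a, b) \<xi>" using assms False by blast
  then obtain c d where cd: "(c, d) \<in> base r" "root_gt (sum_list r) (a, b) (c, d)" by auto
  have "(a, b) \<in> pos_roots (sum_list r)" "(c, d) \<in> pos_roots (sum_list r)"
    using cd base_subset assms roots_m_pos by blast+
  then show ?thesis using cd that root_gt_iff by blast
qed (use that in blast)

lemma base_bounds: "(i, j) \<in> base r \<Longrightarrow> i < j \<and> j < sum_list r \<and> (i, j) \<in> roots_m r"
  using base_subset by (force simp: roots_m_iff)

text \<open>
  If two base roots in columns of one diagonal block descended to the right, the root in the row of the
  lower one and the column of the left one would be in \<open>M\<close> with no base root to its left or below it.
\<close>

lemma base_antitone_col: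
  assumes "(i, j) \<in> base r" "(i', j') \<in> base r" "j < j'" "same_block r j j'"
  shows "i' < i"
proof (rule ccontr)
  assume "\<not> i' < i"
  moreover have "i \<noteq> i'" using base_row_col[OF assms(1,2)] assms(3) by auto
  ultimately have "i < i'" by simp
  have "(i', j) \<in> roots_m r"
    using roots_m_col_cong[of r j j' i'] assms base_bounds[OF assms(2)] by simp
  then show False
  proof (cases rule: base_dominates)
    case 1
    then show ?thesis using base_row_col[OF assms(1) 1] \<open>i < i'\<close> by simp
  next
    case (2 c)
    then show ?thesis using base_row_col[OF assms(2) 2(2)] assms(3) by simp
  next
    case (3 d)
    then show ?thesis using base_row_col[OF assms(1) 3(2)] \<open>i < i'\<close> by simp
  qed
qed

lemma base_antitone_row:
  assumes "(i, j) \<in> base r" "(i', j') \<in> base r" "i < i'" "same_block r i i'"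
  shows "j' < j"
proof (rule ccontr)
  assume "\<not> j' < j"
  moreover have "j \<noteq> j'" using base_row_col[OF assms(1,2)] assms(3) by auto
  ultimately have "j < j'" by simp
  have "(i', j) \<in> roots_m r"
    using roots_m_row_cong[of r i i' j] assms base_bounds[OF assms(1)] by simp
  then show False
  proof (cases rule: base_dominates)
    case 1
    then show ?thesis using base_row_col[OF assms(1) 1] \<open>i < i'\<close> by simp
  next
    case (2 c)
    then show ?thesis using base_row_col[OF assms(2) 2(2)] \<open>j < j'\<close> by simp
  next
    case (3 d)
    then show ?thesis using base_row_col[OF assms(1) 3(2)] \<open>i < i'\<close> by simp
  qed
qed

text \<open>
  A row \<open>p > i\<close> that meets \<open>M\<close> in column \<open>j\<close> has a base root to the left of that place, since the only
  base root of column \<open>j\<close> is in the higher row \<open>i\<close>. So the minor of a base root uses all rows and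
  columns of the lower left corner at \<open>(i, j)\<close> in which the generic matrix is not zero.
\<close>

lemma base_below_rows:
  assumes "(i, j) \<in> base r"
  shows "fst ` base_below r (i, j) = {p. i < p \<and> (p, j) \<in> roots_m r}" (is "?L = ?R")
proof (rule subset_antisym; rule subsetI)
  fix p assume "p \<in> ?L"
  then obtain c where "(p, c) \<in> base r" "i < p" "c < j" by (auto simp: base_below_def)
  then show "p \<in> ?R" using roots_m_mono[of p c r p j] base_bounds[of p c r] base_bounds[OF assms] by simp
next
  fix p assume p: "p \<in> ?R"
  then have "(p, j) \<in> roots_m r" by simp
  then show "p \<in> ?L"
  proof (cases rule: base_dominates)
    case (2 c)
    then have "(p, c) \<in> base_below r (i, j)" using p by (simp add: base_below_def)
    then show ?thesis by force
  next
    case 1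
    then show ?thesis using base_row_col[OF assms 1] p by simp
  next
    case (3 d)
    then show ?thesis using base_row_col[OF assms 3(2)] p by simp
  qed
qed

lemma base_below_cols:
  assumes "(i, j) \<in> base r"
  shows "snd ` base_below r (i, j) = {q. q < j \<and> (i, q) \<in> roots_m r}" (is "?L = ?R")
proof (rule subset_antisym; rule subsetI)
  fix q assume "q \<in> ?L"
  then obtain a where "(a, q) \<in> base r" "i < a" "q < j" by (auto simp: base_below_def)
  then show "q \<in> ?R" using roots_m_mono[of a q r i q] base_bounds[of a q r] by simp
next
  fix q assume q: "q \<in> ?R"
  then have "(i, q) \<in> roots_m r" by simp
  then show "q \<in> ?L"
  proof (cases rule: base_dominates)
    case (3 d)
    then have "(d, q) \<in> base_below r (i, j)" using q by (simp add: base_below_def)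
    then show ?thesis by force
  next
    case 1
    then show ?thesis using base_row_col[OF assms 1] q by simp
  next
    case (2 c)
    then show ?thesis using base_row_col[OF assms 2(2)] q by simp
  qed
qed

text \<open>
  The minors in \<open>L_poly\<close> arise from those of base roots by moving the last column, or the first row,
  inside its diagonal block. By the antitone arrangement of the base this leaves the other columns and
  rows as they are.
\<close>

lemma base_below_col_cong:
  assumes "(i, j) \<in> base r" "j \<le> m" "same_block r j m"
  shows "base_below r (i, m) = base_below r (i, j)"
proof -
  have "q < j" if "(p, q) \<in> base r" "i < p" "q < m" for p q
  proof (rule ccontr)
    assume "\<not> q < j"
    moreover have "j \<noteq> q" using base_row_col[OF assms(1) that(1)] that(2) by auto
    ultimately have "j < q" by simp
    then show False
      using base_antitone_col[OF assms(1) that(1)] same_block_between[OF assms(3), of q] that by simp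
  qed
  then show ?thesis using assms(2) by (auto simp: base_below_def)
qed

lemma base_below_row_cong:
  assumes "(k, l) \<in> base r" "m \<le> k" "same_block r m k"
  shows "base_below r (m, l) = base_below r (k, l)"
proof -
  have "k < p" if "(p, q) \<in> base r" "m < p" "q < l" for p q
  proof (rule ccontr)
    assume "\<not> k < p"
    moreover have "k \<noteq> p" using base_row_col[OF assms(1) that(1)] that(3) by auto
    ultimately have "p < k" by simp
    then show False
      using base_antitone_row[OF that(1) assms(1)] same_block_between[OF assms(3), of p] that by simp
  qed
  then show ?thesis using assms(2) by (auto simp: base_below_def)
qed

lemma finite_base: "finite (base r)"
  by (rule finite_subset[of _ "{..<sum_list r} \<times> {..<sum_list r}"]) (auto dest: base_bounds)

lemma inj_on_base: "inj_on fst (base r)" "inj_on snd (base r)"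
proof -
  have "x = y" if "x \<in> base r" "y \<in> base r" "fst x = fst y \<or> snd x = snd y" for x y
    using base_row_col[of "fst x" "snd x" r "fst y" "snd y"] that by (simp add: prod_eq_iff)
  then show "inj_on fst (base r)" "inj_on snd (base r)" unfolding inj_on_def by blast+
qed

lemma base_below_card:
  "card (fst ` base_below r \<gamma>) = card (base_below r \<gamma>)"
  "card (snd ` base_below r \<gamma>) = card (base_below r \<gamma>)"
proof -
  have "base_below r \<gamma> \<subseteq> base r" by (auto simp: base_below_def)
  then show "card (fst ` base_below r \<gamma>) = card (base_below r \<gamma>)"
    "card (snd ` base_below r \<gamma>) = card (base_below r \<gamma>)"
    using inj_on_base inj_on_subset card_image by metis+
qed

section \<open>The transformation of the minors\<close>

lemma generic_mat_simps:
  "generic_mat r \<in> carrier_mat (sum_list r) (sum_list r)"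
  "p < sum_list r \<Longrightarrow> q < sum_list r \<Longrightarrow> generic_mat r $$ (p, q) = (if (p, q) \<in> roots_m r then Var (p, q) else 0)"
  by (simp_all add: generic_mat_def)

lemma generic_mult_zero:
  fixes Q :: "'k::comm_ring_1 mpol mat"
  assumes Q: "Q \<in> carrier_mat (sum_list r) (sum_list r)" "upper_triangular Q"
    and pq: "p < sum_list r" "q < sum_list r" "(p, q) \<notin> roots_m r"
  shows "(generic_mat r * Q) $$ (p, q) = 0" "(Q * generic_mat r) $$ (p, q) = 0"
proof -
  let ?n = "sum_list r"
  have X: "(generic_mat r :: 'k mpol mat) \<in> carrier_mat ?n ?n" by (rule generic_mat_simps)
  have "(generic_mat r * Q) $$ (p, q) = (\<Sum>s<?n. generic_mat r $$ (p, s) * Q $$ (s, q))"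
    using Q(1) pq X by (simp add: scalar_prod_def atLeast0LessThan)
  also have "\<dots> = 0"
  proof (intro sum.neutral ballI)
    fix s assume "s \<in> {..<?n}"
    then show "generic_mat r $$ (p, s) * Q $$ (s, q) = 0"
      using roots_m_mono[of p s r p q] pq upper_triangularD[OF Q(2), of q s] Q(1)
      by (cases "q < s") (auto simp: generic_mat_simps)
  qed
  finally show "(generic_mat r * Q) $$ (p, q) = 0" .
  have "(Q * generic_mat r) $$ (p, q) = (\<Sum>s<?n. Q $$ (p, s) * generic_mat r $$ (s, q))"
    using Q(1) pq X by (simp add: scalar_prod_def atLeast0LessThan)
  also have "\<dots> = 0"
  proof (intro sum.neutral ballI)
    fix s assume "s \<in> {..<?n}"
    then show "Q $$ (p, s) * generic_mat r $$ (s, q) = 0"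
      using roots_m_mono[of s q r p q] pq upper_triangularD[OF Q(2), of s p] Q(1)
      by (cases "s < p") (auto simp: generic_mat_simps)
  qed
  finally show "(Q * generic_mat r) $$ (p, q) = 0" .
qed

text \<open>
  Multiplication by \<open>P\<close> from the left adds lower rows to higher ones. The rows of the minor are all rows
  from \<open>i\<close> downwards that do not vanish on the columns up to \<open>m\<close>, so only a triangular square block of
  \<open>P\<close> matters. Multiplication by \<open>Q\<close> from the right adds left columns to right ones, and the columns
  of the minor before \<open>j\<close> are all nonzero columns there; so only column \<open>m\<close> picks up something new,
  namely the columns from \<open>j\<close> on. The terms with \<open>t > m\<close> are zero; with them the sum is the product of
  the row vector of minors and a column of a square block of \<open>Q\<close>.
\<close>

lemma conjugate_minor_col:
  fixes P Q :: "'k::comm_ring_1 mpol mat"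
  assumes ij: "(i, j) \<in> base r" and jk: "same_block r j k" "k < sum_list r" "m \<in> {j..k}"
    and P: "P \<in> carrier_mat (sum_list r) (sum_list r)" "upper_triangular P"
    and Q: "Q \<in> carrier_mat (sum_list r) (sum_list r)" "upper_triangular Q"
  shows "det (submatrix (P * generic_mat r * Q)
      (insert i (fst ` base_below r (i, m))) (insert m (snd ` base_below r (i, m)))) =
    (\<Prod>p | i \<le> p \<and> (p, j) \<in> roots_m r. P $$ (p, p)) * (\<Prod>q | q < j \<and> (i, q) \<in> roots_m r. Q $$ (q, q)) *
    (\<Sum>t\<in>{j..k}. Q $$ (t, m) * minor r (i, t))"
proof -
  define n where "n = sum_list r"
  define X where "X = (generic_mat r :: 'k mpol mat)"
  define I where "I = {p. i \<le> p \<and> (p, j) \<in> roots_m r}"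
  define C where "C = {q. q < j \<and> (i, q) \<in> roots_m r}"
  note bd = base_bounds[OF ij, folded n_def]
  note P = P[folded n_def] and Q = Q[folded n_def] and jk = jk[folded n_def]
  have X: "X \<in> carrier_mat n n" by (simp add: X_def n_def generic_mat_simps)
  have I': "I = insert i {p. i < p \<and> (p, j) \<in> roots_m r}" using bd by (auto simp: I_def)
  have blk: "base_below r (i, t) = base_below r (i, j)" if "t \<in> {j..k}" for t
    using base_below_col_cong[OF ij, of t] that same_block_between[OF jk(1), of t] by simp
  have IC: "insert i (fst ` base_below r (i, t)) = I" "snd ` base_below r (i, t) = C" if "t \<in> {j..k}" for t
    unfolding blk[OF that] base_below_rows[OF ij] base_below_cols[OF ij] by (simp_all add: I' C_def)
  have In: "I \<subseteq> {..<n}" "C \<subseteq> {..<n}" "insert m C \<subseteq> {..<n}"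
    using jk bd by (auto simp: I_def C_def n_def roots_m_iff)
  have cards: "card I = Suc (card C)"
  proof -
    have "finite (fst ` base_below r (i, j))" using In(1) finite_subset[of "fst ` base_below r (i, j)" "{..<n}"] IC[of j] jk(3) by auto
    moreover have "i \<notin> fst ` base_below r (i, j)" by (auto simp: base_below_def)
    ultimately show ?thesis using IC[of j] jk(3) base_below_card[of r "(i, j)"]
      by (metis atLeastAtMost_iff card_insert_disjoint order.refl order.trans)
  qed
  have tri: "(\<forall>a<n. \<forall>b<a. Q $$ (a, b) = 0) \<or> (\<forall>b<n. \<forall>a<b. Q $$ (a, b) = 0)"
    using Q by (auto simp: upper_triangular_def)
  have Q0: "Q $$ (s, c) = 0" if "c < s" "s < n" for s c
    using upper_triangularD[OF Q(2), of c s] Q(1) that by simp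
  have X0: "X $$ (p, q) = 0" if "p \<in> I" "q < j" "q \<notin> C" for p q
  proof -
    have "(p, q) \<notin> roots_m r" using that roots_m_mono[of p q r i q] bd by (auto simp: I_def C_def n_def)
    then show ?thesis using that In bd by (auto simp: X_def generic_mat_simps n_def subset_iff)
  qed
  have XQ: "X * Q \<in> carrier_mat n n" using X Q by simp
  have "P * X * Q = P * (X * Q)" using P X Q by (simp add: assoc_mult_mat)
  also have "submatrix \<dots> I (insert m C) = submatrix P I I * submatrix (X * Q) I (insert m C)"
  proof (rule submatrix_mult[OF P(1) XQ In(1,1,3)])
    fix p s q assume s: "p \<in> I" "s < n" "s \<notin> I" "q \<in> insert m C"
    show "P $$ (p, s) * (X * Q) $$ (s, q) = 0"
    proof (cases "s < p")
      case True
      then show ?thesis using upper_triangularD[OF P(2), of s p] P(1) s In by auto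
    next
      case False
      then have "(s, j) \<notin> roots_m r" using s by (auto simp: I_def)
      then have "(s, m) \<notin> roots_m r"
        using roots_m_col_cong[of r j m s] same_block_between[OF jk(1), of m] jk by (simp add: n_def)
      moreover have "q \<le> m" "q < n" using s jk In by (auto simp: C_def)
      ultimately have "(s, q) \<notin> roots_m r" using roots_m_mono[of s q r s m] jk by (auto simp: n_def)
      then show ?thesis using generic_mult_zero(1)[of Q r s q] s Q \<open>q < n\<close> by (simp add: X_def n_def)
    qed
  qed
  finally have "det (submatrix (P * X * Q) I (insert m C)) = det (submatrix P I I) * det (submatrix (X * Q) I (insert m C))"
  proof -
    assume e: "submatrix (P * X * Q) I (insert m C) = submatrix P I I * submatrix (X * Q) I (insert m C)"
    have "card (insert m C) = card I"
      using cards jk(3) finite_subset[OF In(2)] by (auto simp: C_def)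
    then show ?thesis unfolding e
      by (intro det_mult[of _ "card I"]) (metis submatrix_carrier P(1) XQ In)+
  qed
  also have "det (submatrix P I I) = (\<Prod>p\<in>I. P $$ (p, p))"
    by (rule det_submatrix_upper_triangular[OF P(1) In(1) P(2)])
  also have "det (submatrix (X * Q) I (insert m C)) =
    (\<Prod>c\<in>C. Q $$ (c, c)) * (\<Sum>t\<in>{j..k}. Q $$ (t, m) * det (submatrix X I (insert t C)))"
  proof (rule det_submatrix_mult_insert_col[OF X Q(1) tri In(1,2) _ cards _ jk(3)])
    show "{j..k} \<subseteq> {..<n}" using jk by auto
    show "{j..k} \<inter> C = {}" by (auto simp: C_def)
    show "{c \<in> C. c < t} = {c \<in> C. c < m}" if "t \<in> {j..k}" for t
      using that jk(3) by (auto simp: C_def)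
    show "X $$ (p, q) * Q $$ (q, c) = 0" if "p \<in> I" "q < n" "q \<notin> C" "c \<in> C" for p q c
      using X0[of p q] Q0[of c q] that by (cases "q < j") (auto simp: C_def)
    show "X $$ (p, q) * Q $$ (q, m) = 0" if "p \<in> I" "q < n" "q \<notin> C" "q \<notin> {j..k}" for p q
      using X0[of p q] Q0[of m q] that jk(3) by (cases "q < j") auto
  qed
  also have "(\<Sum>t\<in>{j..k}. Q $$ (t, m) * det (submatrix X I (insert t C))) = (\<Sum>t\<in>{j..k}. Q $$ (t, m) * minor r (i, t))"
    by (intro sum.cong refl) (simp add: minor_def IC X_def)
  finally show ?thesis unfolding IC[OF jk(3)] I_def C_def X_def by (simp add: mult.assoc)
qed

text \<open>
  The mirror image: here the first row \<open>m\<close> is the one that moves within its block.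
\<close>

lemma conjugate_minor_row:
  fixes P Q :: "'k::comm_ring_1 mpol mat"
  assumes kl: "(k, l) \<in> base r" and jk: "same_block r j k" "m \<in> {j..k}"
    and P: "P \<in> carrier_mat (sum_list r) (sum_list r)" "upper_triangular P"
    and Q: "Q \<in> carrier_mat (sum_list r) (sum_list r)" "upper_triangular Q"
  shows "det (submatrix (P * generic_mat r * Q)
      (insert m (fst ` base_below r (m, l))) (insert l (snd ` base_below r (m, l)))) =
    (\<Prod>q | q \<le> l \<and> (k, q) \<in> roots_m r. Q $$ (q, q)) * (\<Prod>p | k < p \<and> (p, l) \<in> roots_m r. P $$ (p, p)) *
    (\<Sum>t\<in>{j..k}. P $$ (m, t) * minor r (t, l))"
proof -
  define n where "n = sum_list r"
  define X where "X = (generic_mat r :: 'k mpol mat)"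
  define J where "J = {q. q \<le> l \<and> (k, q) \<in> roots_m r}"
  define R where "R = {p. k < p \<and> (p, l) \<in> roots_m r}"
  note bd = base_bounds[OF kl, folded n_def]
  note P = P[folded n_def] and Q = Q[folded n_def] and jk = jk[folded n_def]
  have X: "X \<in> carrier_mat n n" by (simp add: X_def n_def generic_mat_simps)
  have J': "J = insert l {q. q < l \<and> (k, q) \<in> roots_m r}" using bd by (auto simp: J_def)
  have blk: "base_below r (t, l) = base_below r (k, l)" if "t \<in> {j..k}" for t
    using base_below_row_cong[OF kl, of t] that same_block_between[OF jk(1), of t] by simp
  have RJ: "insert l (snd ` base_below r (t, l)) = J" "fst ` base_below r (t, l) = R" if "t \<in> {j..k}" for t
    unfolding blk[OF that] base_below_rows[OF kl] base_below_cols[OF kl] by (simp_all add: J' R_def)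
  have In: "J \<subseteq> {..<n}" "R \<subseteq> {..<n}" "insert m R \<subseteq> {..<n}"
    using jk bd by (auto simp: J_def R_def n_def roots_m_iff)
  have cards: "card J = Suc (card R)"
  proof -
    have "finite (snd ` base_below r (k, l))" using In(1) finite_subset[of "snd ` base_below r (k, l)" "{..<n}"] RJ[of k] jk(2) by auto
    moreover have "l \<notin> snd ` base_below r (k, l)" by (auto simp: base_below_def)
    ultimately show ?thesis using RJ[of k] jk(2) base_below_card[of r "(k, l)"]
      by (metis atLeastAtMost_iff card_insert_disjoint order.refl order.trans)
  qed
  have P0: "P $$ (a, s) = 0" if "s < a" "a < n" for s a
    using upper_triangularD[OF P(2), of s a] P(1) that by simp
  have X0: "X $$ (p, q) = 0" if "q \<in> J" "k < p" "p < n" "p \<notin> R" for p q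
  proof -
    have "(p, q) \<notin> roots_m r" using that roots_m_mono[of p q r p l] bd by (auto simp: J_def R_def n_def)
    then show ?thesis using that In by (auto simp: X_def generic_mat_simps n_def subset_iff)
  qed
  have PX: "P * X \<in> carrier_mat n n" using X P by simp
  have "submatrix (P * X * Q) (insert m R) J = submatrix (P * X) (insert m R) J * submatrix Q J J"
  proof (rule submatrix_mult[OF PX Q(1) In(3,1,1)])
    fix p s q assume s: "p \<in> insert m R" "s < n" "s \<notin> J" "q \<in> J"
    show "(P * X) $$ (p, s) * Q $$ (s, q) = 0"
    proof (cases "q < s")
      case True
      then show ?thesis using upper_triangularD[OF Q(2), of q s] Q(1) s In by auto
    next
      case False
      then have "(k, s) \<notin> roots_m r" using s by (auto simp: J_def)
      then have "(m, s) \<notin> roots_m r"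
        using roots_m_row_cong[of r m k s] same_block_between[OF jk(1), of m] jk by simp
      moreover have "m \<le> p" "p < n" using s jk In by (auto simp: R_def)
      ultimately have "(p, s) \<notin> roots_m r" using roots_m_mono[of p s r m s] s by (auto simp: n_def)
      then show ?thesis using generic_mult_zero(2)[of P r p s] s P \<open>p < n\<close> by (simp add: X_def n_def)
    qed
  qed
  then have "det (submatrix (P * X * Q) (insert m R) J) = det (submatrix (P * X) (insert m R) J) * det (submatrix Q J J)"
  proof -
    assume e: "submatrix (P * X * Q) (insert m R) J = submatrix (P * X) (insert m R) J * submatrix Q J J"
    have "card (insert m R) = card J"
      using cards jk(2) finite_subset[OF In(2)] by (auto simp: R_def)
    then show ?thesis unfolding e
      by (intro det_mult[of _ "card J"]) (metis submatrix_carrier Q(1) PX In)+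
  qed
  also have "det (submatrix Q J J) = (\<Prod>p\<in>J. Q $$ (p, p))"
    by (rule det_submatrix_upper_triangular[OF Q(1) In(1) Q(2)])
  also have "det (submatrix (P * X) (insert m R) J) =
    (\<Prod>c\<in>R. P $$ (c, c)) * (\<Sum>t\<in>{j..k}. P $$ (m, t) * det (submatrix X (insert t R) J))"
  proof (rule det_submatrix_mult_insert_row[OF X P In(1,2) _ cards _ jk(2)])
    show "{j..k} \<subseteq> {..<n}" using bd by auto
    show "{j..k} \<inter> R = {}" by (auto simp: R_def)
    show "{c \<in> R. c < t} = {c \<in> R. c < m}" if "t \<in> {j..k}" for t
      using that jk(2) by (auto simp: R_def)
    show "P $$ (a, p) * X $$ (p, q) = 0" if "q \<in> J" "p < n" "p \<notin> R" "a \<in> R" for a p q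
      using X0[of q p] P0[of p a] that In(2) by (cases "k < p") (auto simp: R_def)
    show "P $$ (m, p) * X $$ (p, q) = 0" if "q \<in> J" "p < n" "p \<notin> R" "p \<notin> {j..k}" for p q
      using X0[of q p] P0[of p m] that jk(2) In(3) by (cases "k < p") auto
  qed
  also have "(\<Sum>t\<in>{j..k}. P $$ (m, t) * det (submatrix X (insert t R) J)) = (\<Sum>t\<in>{j..k}. P $$ (m, t) * minor r (t, l))"
    by (intro sum.cong refl) (simp add: minor_def RJ X_def)
  finally show ?thesis unfolding RJ[OF jk(2)] R_def J_def X_def by (simp add: mult_ac)
qed

lemma Cst_prod: "Cst (prod f A) = (\<Prod>x\<in>A. Cst (f x))"
  by (induction A rule: infinite_finite_induct) (simp_all add: Cst_simps)

lemma Cst_sum: "Cst (sum f A) = (\<Sum>x\<in>A. Cst (f x))"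
  by (induction A rule: infinite_finite_induct) (simp_all add: Cst_simps)

lemma poly_subst_det_submatrix:
  assumes A: "A \<in> carrier_mat n n" and IJ: "I \<subseteq> {..<n}" "J \<subseteq> {..<n}"
  shows "poly_subst s (det (submatrix A I J)) = det (submatrix (map_mat (poly_subst s) A) I J)"
proof -
  interpret h: comm_ring_hom "poly_subst s"
  proof
    show "poly_subst s 1 = 1" using poly_subst_Cst[of s 1] by (simp add: Cst_simps)
  qed (simp_all add: poly_subst_0 poly_subst_add poly_subst_mult)
  have mA: "map_mat (poly_subst s) A \<in> carrier_mat n n" using A by simp
  have "map_mat (poly_subst s) (submatrix A I J) = submatrix (map_mat (poly_subst s) A) I J"
    unfolding submatrix_eq_mat[OF A IJ] submatrix_eq_mat[OF mA IJ]
  proof (rule eq_matI, goal_cases)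
    case (1 u v)
    then have "pick I u < n" "pick J v < n" using IJ pick_in_set by auto
    then show ?case using 1 A by simp
  qed auto
  then show ?thesis by (metis h.hom_det)
qed

lemma base_below_bounds:
  assumes "a < sum_list r" "b < sum_list r"
  shows "insert a (fst ` base_below r (a, b)) \<subseteq> {..<sum_list r}"
    "insert b (snd ` base_below r (a, b)) \<subseteq> {..<sum_list r}"
  using assms base_bounds by (fastforce simp: base_below_def)+

lemma act_minor:
  fixes g :: "'k::field mat"
  assumes g: "g \<in> borel_subgroup (sum_list r)" and "a < sum_list r" "b < sum_list r"
  shows "act_poly r g (minor r (a, b)) = det (submatrix (Ad_inv_mat r g)
    (insert a (fst ` base_below r (a, b))) (insert b (snd ` base_below r (a, b))))"
proof -
  have X: "(generic_mat r :: 'k mpol mat) \<in> carrier_mat (sum_list r) (sum_list r)" by (rule generic_mat_simps)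
  show ?thesis
    unfolding act_poly_generic[OF g, symmetric] unfolding act_poly_def minor_def fst_conv snd_conv
    by (rule poly_subst_det_submatrix[OF X base_below_bounds[OF assms(2,3)]])
qed

section \<open>Weights\<close>

text \<open>
  The weight of the minor of the base root \<open>(i, j)\<close> is this factor times \<open>g\<^sub>i\<^sub>i\<^sup>-\<^sup>1 g\<^sub>j\<^sub>j\<close>.
  It is split off because the minors with a moved column (or row) share it, while the entry of the moved
  column (or row) becomes part of a matrix coefficient of \<open>g\<close> (or \<open>g\<^sup>-\<^sup>1\<close>).
\<close>

definition base_weight :: "nat list \<Rightarrow> 'k::field mat \<Rightarrow> nat \<times> nat \<Rightarrow> 'k" where
  "base_weight r g \<xi> =
    (\<Prod>p | fst \<xi> < p \<and> (p, snd \<xi>) \<in> roots_m r. (inv\<^bsub>ring_mat TYPE('k) (sum_list r) ()\<^esub> g) $$ (p, p)) *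
    (\<Prod>q | q < snd \<xi> \<and> (fst \<xi>, q) \<in> roots_m r. g $$ (q, q))"

context
  fixes r :: "nat list" and g h :: "'k::field mat"
  assumes g: "g \<in> borel_subgroup (sum_list r)"
  defines "h \<equiv> inv\<^bsub>ring_mat TYPE('k) (sum_list r) ()\<^esub> g"
begin

lemma Cst_borel:
  "map_mat Cst g \<in> carrier_mat (sum_list r) (sum_list r)" "upper_triangular (map_mat Cst g)"
  "map_mat Cst h \<in> carrier_mat (sum_list r) (sum_list r)" "upper_triangular (map_mat Cst h)"
  using borel_inv[OF g] by (auto simp: h_def upper_triangular_def Cst_simps)

lemma borel_entry: "p < sum_list r \<Longrightarrow> q < sum_list r \<Longrightarrow> map_mat Cst g $$ (p, q) = Cst (g $$ (p, q))"
   "p < sum_list r \<Longrightarrow> q < sum_list r \<Longrightarrow> map_mat Cst h $$ (p, q) = Cst (h $$ (p, q))"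
  using borel_inv(1,2)[OF g] by (auto simp: h_def)

lemma Ad_inv_mat_eq: "Ad_inv_mat r g = map_mat Cst h * generic_mat r * map_mat Cst g"
  by (simp add: Ad_inv_mat_def h_def)

lemma act_minor_col:
  assumes ij: "(i, j) \<in> base r" and jk: "same_block r j k" "k < sum_list r" "m \<in> {j..k}"
  shows "act_poly r g (minor r (i, m)) =
    Cst (base_weight r g (i, j) * h $$ (i, i)) * (\<Sum>t\<in>{j..k}. Cst (g $$ (t, m)) * minor r (i, t))"
proof -
  let ?R = "{p. i < p \<and> (p, j) \<in> roots_m r}" and ?C = "{q. q < j \<and> (i, q) \<in> roots_m r}"
  note bd = base_bounds[OF ij]
  have m: "m < sum_list r" using jk by auto
  have f: "finite ?R" by (rule finite_subset[of _ "{..<j}"]) (auto simp: roots_m_iff)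
  have I: "{p. i \<le> p \<and> (p, j) \<in> roots_m r} = insert i ?R" using bd by auto
  have "(\<Prod>p | i \<le> p \<and> (p, j) \<in> roots_m r. map_mat Cst h $$ (p, p)) =
      (\<Prod>p | i \<le> p \<and> (p, j) \<in> roots_m r. Cst (h $$ (p, p)))"
    by (intro prod.cong refl borel_entry) (auto simp: roots_m_iff)
  also have "\<dots> = Cst (h $$ (i, i)) * (\<Prod>p\<in>?R. Cst (h $$ (p, p)))" unfolding I using f by simp
  finally have 1: "(\<Prod>p | i \<le> p \<and> (p, j) \<in> roots_m r. map_mat Cst h $$ (p, p)) =
      Cst (h $$ (i, i)) * (\<Prod>p\<in>?R. Cst (h $$ (p, p)))" .
  have 2: "(\<Prod>p\<in>?C. map_mat Cst g $$ (p, p)) = (\<Prod>p\<in>?C. Cst (g $$ (p, p)))"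
    by (intro prod.cong refl borel_entry) (auto simp: roots_m_iff)
  have 3: "(\<Sum>t\<in>{j..k}. map_mat Cst g $$ (t, m) * minor r (i, t)) = (\<Sum>t\<in>{j..k}. Cst (g $$ (t, m)) * minor r (i, t))"
    by (intro sum.cong refl) (use jk m borel_entry in auto)
  have "i < sum_list r" using bd by simp
  from act_minor[OF g this m] show ?thesis
    unfolding Ad_inv_mat_eq conjugate_minor_col[OF ij jk Cst_borel(3,4,1,2)] 1 2 3
    by (simp add: base_weight_def h_def[symmetric] Cst_simps Cst_prod mult_ac)
qed

lemma act_minor_row:
  assumes kl: "(k, l) \<in> base r" and jk: "same_block r j k" "m \<in> {j..k}"
  shows "act_poly r g (minor r (m, l)) =
    Cst (base_weight r g (k, l) * g $$ (l, l)) * (\<Sum>t\<in>{j..k}. Cst (h $$ (m, t)) * minor r (t, l))"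
proof -
  let ?R = "{p. k < p \<and> (p, l) \<in> roots_m r}" and ?C = "{q. q < l \<and> (k, q) \<in> roots_m r}"
  note bd = base_bounds[OF kl]
  have m: "m < sum_list r" using jk bd by auto
  have f: "finite ?C" by (rule finite_subset[of _ "{..<l}"]) (auto simp: roots_m_iff)
  have J: "{q. q \<le> l \<and> (k, q) \<in> roots_m r} = insert l ?C" using bd by auto
  have 1: "(\<Prod>p\<in>?R. map_mat Cst h $$ (p, p)) = (\<Prod>p\<in>?R. Cst (h $$ (p, p)))"
    by (intro prod.cong refl borel_entry) (auto simp: roots_m_iff)
  have "(\<Prod>q | q \<le> l \<and> (k, q) \<in> roots_m r. map_mat Cst g $$ (q, q)) =
      (\<Prod>q | q \<le> l \<and> (k, q) \<in> roots_m r. Cst (g $$ (q, q)))"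
    by (intro prod.cong refl borel_entry) (auto simp: roots_m_iff)
  also have "\<dots> = Cst (g $$ (l, l)) * (\<Prod>q\<in>?C. Cst (g $$ (q, q)))" unfolding J using f by simp
  finally have 2: "(\<Prod>q | q \<le> l \<and> (k, q) \<in> roots_m r. map_mat Cst g $$ (q, q)) =
      Cst (g $$ (l, l)) * (\<Prod>q\<in>?C. Cst (g $$ (q, q)))" .
  have 3: "(\<Sum>t\<in>{j..k}. map_mat Cst h $$ (m, t) * minor r (t, l)) = (\<Sum>t\<in>{j..k}. Cst (h $$ (m, t)) * minor r (t, l))"
    by (intro sum.cong refl) (use bd m borel_entry in auto)
  have "l < sum_list r" using bd by simp
  from act_minor[OF g m this] show ?thesis
    unfolding Ad_inv_mat_eq conjugate_minor_row[OF kl jk Cst_borel(3,4,1,2)] 1 2 3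
    by (simp add: base_weight_def h_def[symmetric] Cst_simps Cst_prod mult_ac)
qed

text \<open>
  Products of upper triangular matrices restrict to diagonal blocks of consecutive indices; here the
  product is \<open>g g\<^sup>-\<^sup>1 = 1\<close>.
\<close>

lemma borel_sum_between:
  assumes ts: "j \<le> t" "s \<le> k" and k: "t < sum_list r" "k < sum_list r"
  shows "(\<Sum>m\<in>{j..k}. g $$ (t, m) * h $$ (m, s)) = of_bool (t = s)"
proof -
  note bi = borel_inv[OF g, folded h_def]
  have n: "t < sum_list r" "s < sum_list r" using ts k by auto
  have z: "g $$ (t, m) * h $$ (m, s) = 0" if "m < t \<or> s < m" "m < sum_list r" for m
    using that upper_triangularD[OF bi(5), of m t] upper_triangularD[OF bi(6), of s m] bi(1,2) n by auto
  have "of_bool (t = s) = (g * h) $$ (t, s)" using bi(3) n by simp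
  also have "\<dots> = (\<Sum>m<sum_list r. g $$ (t, m) * h $$ (m, s))"
    using bi(1,2) n by (simp add: scalar_prod_def atLeast0LessThan)
  also have "\<dots> = (\<Sum>m\<in>{t..s}. g $$ (t, m) * h $$ (m, s))"
  proof (rule sum.mono_neutral_right)
    show "\<forall>m\<in>{..<sum_list r} - {t..s}. g $$ (t, m) * h $$ (m, s) = 0"
      by (intro ballI z) auto
  qed (use n in auto)
  also have "\<dots> = (\<Sum>m\<in>{j..k}. g $$ (t, m) * h $$ (m, s))"
  proof (rule sum.mono_neutral_left)
    show "\<forall>m\<in>{j..k} - {t..s}. g $$ (t, m) * h $$ (m, s) = 0"
      by (intro ballI z) (use k in auto)
  qed (use ts in auto)
  finally show ?thesis ..
qed

lemma borel_inv_diag: "j < sum_list r \<Longrightarrow> g $$ (j, j) * h $$ (j, j) = 1"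
  using borel_sum_between[of j j j j] by simp

text \<open>
  The row of minors \<open>M\<^sub>i\<^sub>m\<close> is multiplied by a block of \<open>g\<close> from the right and the column of minors
  \<open>M\<^sub>m\<^sub>l\<close> by the same block of \<open>g\<^sup>-\<^sup>1\<close> from the left. These cancel in the sum of products. The
  remaining weight is a factor depending on the column \<open>j\<close> of \<open>\<xi>\<close> times one depending on the column
  \<open>l\<close> of \<open>\<xi>'\<close>.
\<close>

lemma act_L_poly:
  assumes ij: "(i, j) \<in> base r" and kl: "(k, l) \<in> base r" and jk: "(j, k) \<in> roots_r r"
  shows "act_poly r g (L_poly r (j, l)) =
    Cst (base_weight r g (i, j) * h $$ (i, i) * (base_weight r g (k, l) * g $$ (l, l))) * L_poly r (j, l)"
proof -
  let ?u = "Cst (base_weight r g (i, j) * h $$ (i, i)) :: 'k mpol"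
  let ?v = "Cst (base_weight r g (k, l) * g $$ (l, l)) :: 'k mpol"
  have b: "same_block r j k" "k < sum_list r" "j \<le> k" using jk by (auto simp: roots_r_def pos_roots_def)
  have gh: "(\<Sum>m\<in>{j..k}. Cst (g $$ (t, m)) * Cst (h $$ (m, s))) = (of_bool (t = s) :: 'k mpol)"
    if ts: "t \<in> {j..k}" "s \<in> {j..k}" for t s
  proof -
    have "Cst (\<Sum>m\<in>{j..k}. g $$ (t, m) * h $$ (m, s)) = Cst (of_bool (t = s))"
      using borel_sum_between[of j t s k] ts b by simp
    then have "(\<Sum>m\<in>{j..k}. Cst (g $$ (t, m)) * Cst (h $$ (m, s))) = Cst (of_bool (t = s))"
      by (simp add: Cst_sum Cst_simps)
    then show ?thesis by (cases "t = s") (simp_all add: Cst_simps)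
  qed
  let ?M = "\<lambda>t. minor r (i, t) :: 'k mpol" and ?N = "\<lambda>s. minor r (s, l) :: 'k mpol"
  have "act_poly r g (L_poly r (j, l)) = (\<Sum>m\<in>{j..k}. act_poly r g (?M m) * act_poly r g (?N m))"
    unfolding L_poly_eq[OF ij kl jk] by (simp add: act_poly_def poly_subst_sum poly_subst_mult)
  also have "\<dots> = (\<Sum>m\<in>{j..k}. (?u * (\<Sum>t\<in>{j..k}. Cst (g $$ (t, m)) * ?M t)) * (?v * (\<Sum>s\<in>{j..k}. Cst (h $$ (m, s)) * ?N s)))"
    by (intro sum.cong refl arg_cong2[where f = "(*)"] act_minor_col[OF ij b(1,2)] act_minor_row[OF kl b(1)])
  also have "\<dots> = ?u * ?v * (\<Sum>m\<in>{j..k}. \<Sum>t\<in>{j..k}. \<Sum>s\<in>{j..k}. Cst (g $$ (t, m)) * Cst (h $$ (m, s)) * (?M t * ?N s))"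
    by (simp add: sum_distrib_left sum_product mult_ac)
  also have "(\<Sum>m\<in>{j..k}. \<Sum>t\<in>{j..k}. \<Sum>s\<in>{j..k}. Cst (g $$ (t, m)) * Cst (h $$ (m, s)) * (?M t * ?N s)) =
      (\<Sum>t\<in>{j..k}. \<Sum>s\<in>{j..k}. (\<Sum>m\<in>{j..k}. Cst (g $$ (t, m)) * Cst (h $$ (m, s))) * (?M t * ?N s))"
    unfolding sum_distrib_right
    by (subst sum.swap, rule sum.cong[OF refl], subst sum.swap, rule refl)
  also have "\<dots> = (\<Sum>t\<in>{j..k}. \<Sum>s\<in>{j..k}. of_bool (t = s) * (?M t * ?N s))"
    by (intro sum.cong refl) (simp add: gh)
  also have "\<dots> = L_poly r (j, l)"
    unfolding L_poly_eq[OF ij kl jk] by (intro sum.cong refl) (simp add: if_distrib if_distribR of_bool_def cong: if_cong)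
  finally show ?thesis by (simp add: Cst_simps)
qed

end

section \<open>Polynomials on the nilradical\<close>

lemma poly_m_closed:
  "0 \<in> poly_m r" "1 \<in> poly_m r"
  "p \<in> poly_m r \<Longrightarrow> q \<in> poly_m r \<Longrightarrow> p + q \<in> poly_m r"
  "p \<in> poly_m r \<Longrightarrow> q \<in> poly_m r \<Longrightarrow> p * q \<in> poly_m r"
  "p \<in> poly_m r \<Longrightarrow> - p \<in> poly_m r"
  "\<gamma> \<in> roots_m r \<Longrightarrow> Var \<gamma> \<in> poly_m r"
proof -
  show "- p \<in> poly_m r" if "p \<in> poly_m r" using that by (simp add: poly_m_def)
  show "0 \<in> poly_m r" by (simp add: poly_m_def)
  show "1 \<in> poly_m r" by (simp add: poly_m_def)
  show "p + q \<in> poly_m r" if "p \<in> poly_m r" "q \<in> poly_m r"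
    using that keys_add[of p q] by (auto simp: poly_m_def)
  show "p * q \<in> poly_m r" if pq: "p \<in> poly_m r" "q \<in> poly_m r"
  proof -
    have "Poly_Mapping.keys (a + b) \<subseteq> roots_m r" if "a \<in> Poly_Mapping.keys p" "b \<in> Poly_Mapping.keys q" for a b
      using that pq keys_add[of a b] unfolding poly_m_def by blast
    then show ?thesis using keys_mult[of p q] unfolding poly_m_def by blast
  qed
  show "Var \<gamma> \<in> poly_m r" if "\<gamma> \<in> roots_m r" using that by (auto simp: poly_m_def Var_def)
qed

lemma poly_m_sum: "(\<And>x. x \<in> A \<Longrightarrow> f x \<in> poly_m r) \<Longrightarrow> sum f A \<in> poly_m r"
  by (induction A rule: infinite_finite_induct) (auto intro: poly_m_closed)

lemma poly_m_prod: "(\<And>x. x \<in> A \<Longrightarrow> f x \<in> poly_m r) \<Longrightarrow> prod f A \<in> poly_m r"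
  by (induction A rule: infinite_finite_induct) (auto intro: poly_m_closed)

lemma poly_m_det:
  assumes A: "A \<in> carrier_mat k k" and e: "\<And>u v. u < k \<Longrightarrow> v < k \<Longrightarrow> A $$ (u, v) \<in> poly_m r"
  shows "det A \<in> poly_m r"
  unfolding det_def'[OF A]
proof (rule poly_m_sum)
  fix \<pi> assume "\<pi> \<in> {\<pi>. \<pi> permutes {0..<k}}"
  then have "\<pi> u < k" if "u < k" for u using that by (auto dest: permutes_in_image[of _ _ u])
  then have "(\<Prod>u = 0..<k. A $$ (u, \<pi> u)) \<in> poly_m r" by (intro poly_m_prod e) auto
  then show "signof \<pi> * (\<Prod>u = 0..<k. A $$ (u, \<pi> u)) \<in> poly_m r"
    using poly_m_closed by (auto simp: sign_def)
qed

lemma base_below_insert_card: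
  "card (insert a (fst ` base_below r (a, b))) = Suc (card (base_below r (a, b)))"
  "card (insert b (snd ` base_below r (a, b))) = Suc (card (base_below r (a, b)))"
proof -
  have "finite (base_below r (a, b))"
    by (rule finite_subset[OF _ finite_base[of r]]) (auto simp: base_below_def)
  moreover have "a \<notin> fst ` base_below r (a, b)" "b \<notin> snd ` base_below r (a, b)" by (auto simp: base_below_def)
  ultimately show "card (insert a (fst ` base_below r (a, b))) = Suc (card (base_below r (a, b)))"
    "card (insert b (snd ` base_below r (a, b))) = Suc (card (base_below r (a, b)))"
    by (simp_all add: base_below_card)
qed

lemma minor_in_poly_m:
  assumes "a < sum_list r" "b < sum_list r"
  shows "(minor r (a, b) :: 'k::comm_ring_1 mpol) \<in> poly_m r"
proof -
  note IJ = base_below_bounds[OF assms]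
  show ?thesis
    unfolding minor_def fst_conv snd_conv submatrix_eq_mat[OF generic_mat_simps(1) IJ] base_below_insert_card
  proof (rule poly_m_det[OF mat_carrier])
    fix u v assume uv: "u < Suc (card (base_below r (a, b)))" "v < Suc (card (base_below r (a, b)))"
    then have "pick (insert a (fst ` base_below r (a, b))) u < sum_list r"
      "pick (insert b (snd ` base_below r (a, b))) v < sum_list r"
      using IJ pick_in_set base_below_insert_card by (metis lessThan_iff subsetD)+
    then show "mat (Suc (card (base_below r (a, b)))) (Suc (card (base_below r (a, b)))) (\<lambda>(u, v). (generic_mat r :: 'k mpol mat) $$
       (pick (insert a (fst ` base_below r (a, b))) u, pick (insert b (snd ` base_below r (a, b))) v)) $$ (u, v) \<in> poly_m r"
      using uv by (auto simp: generic_mat_simps intro: poly_m_closed)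
  qed
qed

lemma L_poly_in_poly_m:
  assumes "(i, j) \<in> base r" "(k, l) \<in> base r" "(j, k) \<in> roots_r r"
  shows "L_poly r (j, l) \<in> poly_m r"
  unfolding L_poly_eq[OF assms]
  using base_bounds[OF assms(1)] base_bounds[OF assms(2)]
  by (intro poly_m_sum poly_m_closed minor_in_poly_m) auto

section \<open>The denominators do not vanish\<close>

text \<open>
  Setting the variables in \<open>E\<close> to \<open>1\<close> and all others to \<open>0\<close>. A polynomial is shown to be nonzero by an
  \<open>E\<close> for which the matrix of a minor becomes a permutation matrix.
\<close>

definition specialise :: "(nat \<times> nat) set \<Rightarrow> 'k::comm_ring_1 mpol \<Rightarrow> 'k mpol" where
  "specialise E = poly_subst (\<lambda>v. of_bool (v \<in> E))"

text \<open>
  The submatrix is a permutation matrix; it is inverse to its transpose.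
\<close>

lemma det_submatrix_matching:
  fixes A :: "'a::idom mat"
  assumes A: "A \<in> carrier_mat n n" and I: "fst ` D \<subseteq> {..<n}" and J: "snd ` D \<subseteq> {..<n}"
    and inj: "inj_on fst D" "inj_on snd D"
    and e: "\<And>p q. p \<in> fst ` D \<Longrightarrow> q \<in> snd ` D \<Longrightarrow> A $$ (p, q) = of_bool ((p, q) \<in> D)"
  shows "det (submatrix A (fst ` D) (snd ` D)) \<noteq> 0"
proof -
  let ?I = "fst ` D" and ?J = "snd ` D"
  define k where "k = card D"
  define U where "U = submatrix A ?I ?J"
  have ck: "card ?I = k" "card ?J = k" using inj by (simp_all add: k_def card_image)
  have fin: "finite ?I" "finite ?J" using I J finite_subset by blast+
  have UC: "U \<in> carrier_mat k k" using submatrix_carrier[OF A I J] ck by (simp add: U_def)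
  have Ue: "U $$ (u, v) = of_bool ((pick ?I u, pick ?J v) \<in> D)" if "u < k" "v < k" for u v
    using that e[of "pick ?I u" "pick ?J v"] pick_in_set[of u ?I] pick_in_set[of v ?J] submatrix_eq_mat[OF A I J] ck
    by (simp add: U_def)
  have "U * transpose_mat U = 1\<^sub>m k"
  proof (rule eq_matI)
    fix u v assume "u < dim_row (1\<^sub>m k :: 'a mat)" "v < dim_col (1\<^sub>m k :: 'a mat)"
    then have uv: "u < k" "v < k" by auto
    let ?p = "pick ?I u" and ?p' = "pick ?I v"
    have p: "?p \<in> ?I" "?p' \<in> ?I" using uv ck pick_in_set by metis+
    have iff: "(p, snd d) \<in> D \<longleftrightarrow> p = fst d" if "d \<in> D" for p d
      using that inj_onD[OF inj(2), of "(p, snd d)" d] by (cases d) auto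
    have "(U * transpose_mat U) $$ (u, v) = (\<Sum>w<k. of_bool ((?p, pick ?J w) \<in> D) * of_bool ((?p', pick ?J w) \<in> D))"
      using UC uv by (auto simp: scalar_prod_def atLeast0LessThan Ue intro!: sum.cong)
    also have "\<dots> = (\<Sum>q\<in>?J. of_bool ((?p, q) \<in> D) * of_bool ((?p', q) \<in> D))"
      using sum.reindex_bij_betw[OF bij_betw_pick[OF fin(2)], of "\<lambda>q. of_bool ((?p, q) \<in> D) * of_bool ((?p', q) \<in> D)"]
      unfolding ck .
    also have "\<dots> = (\<Sum>d\<in>D. of_bool (?p = fst d) * of_bool (?p' = fst d))"
      by (subst sum.reindex[OF inj(2)]) (simp add: iff)
    also have "\<dots> = (\<Sum>x\<in>?I. of_bool (?p = x) * of_bool (?p' = x))"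
      by (simp add: sum.reindex[OF inj(1)])
    also have "\<dots> = (\<Sum>x\<in>?I. if ?p = x then of_bool (?p' = ?p) else 0)"
      by (rule sum.cong) auto
    also have "\<dots> = of_bool (?p' = ?p)" using p fin(1) by simp
    also have "\<dots> = of_bool (u = v)"
      using bij_betw_pick[OF fin(1)] uv ck by (auto simp: bij_betw_def inj_on_def)
    finally show "(U * transpose_mat U) $$ (u, v) = 1\<^sub>m k $$ (u, v)" using uv by simp
  qed (use UC in auto)
  then have "det U * det (transpose_mat U) = 1"
    using det_mult[OF UC, of "transpose_mat U"] UC by simp
  then show ?thesis unfolding U_def by auto
qed

lemma specialise_minor:
  assumes "a < sum_list r" "b < sum_list r"
  shows "specialise E (minor r (a, b) :: 'k::comm_ring_1 mpol) =
    det (submatrix (mat (sum_list r) (sum_list r) (\<lambda>v. of_bool (v \<in> roots_m r \<and> v \<in> E)))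
      (insert a (fst ` base_below r (a, b))) (insert b (snd ` base_below r (a, b))))"
proof -
  have X: "(generic_mat r :: 'k mpol mat) \<in> carrier_mat (sum_list r) (sum_list r)" by (rule generic_mat_simps)
  have "mat (sum_list r) (sum_list r) (\<lambda>v. of_bool (v \<in> roots_m r \<and> v \<in> E)) =
    map_mat (poly_subst (\<lambda>v. of_bool (v \<in> E))) (generic_mat r :: 'k mpol mat)"
    by (rule eq_matI) (auto simp: generic_mat_def poly_subst_Var poly_subst_0)
  then show ?thesis
    unfolding specialise_def minor_def fst_conv snd_conv
    by (simp only: poly_subst_det_submatrix[OF X base_below_bounds[OF assms]])
qed

lemma specialise_minor_nonzero:
  assumes ab: "(a, b) \<in> roots_m r"
    and E: "\<And>p q. p \<in> insert a (fst ` base_below r (a, b)) \<Longrightarrow> q \<in> insert b (snd ` base_below r (a, b)) \<Longrightarrow>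
      (p, q) \<in> E \<longleftrightarrow> (p, q) \<in> insert (a, b) (base_below r (a, b))"
  shows "specialise E (minor r (a, b) :: 'k::idom mpol) \<noteq> 0"
proof -
  let ?D = "insert (a, b) (base_below r (a, b))"
  have n: "a < sum_list r" "b < sum_list r" using ab by (auto simp: roots_m_iff)
  have bb: "base_below r (a, b) \<subseteq> base r" by (auto simp: base_below_def)
  have im: "insert a (fst ` base_below r (a, b)) = fst ` ?D" "insert b (snd ` base_below r (a, b)) = snd ` ?D" by auto
  note bd = base_below_bounds[OF n, unfolded im]
  have D: "?D \<subseteq> roots_m r" using ab bb base_subset by blast
  have "inj_on fst (base_below r (a, b))" "inj_on snd (base_below r (a, b))"
    using inj_on_base inj_on_subset[OF _ bb] by blast+
  then have inj: "inj_on fst ?D" "inj_on snd ?D" by (auto simp: base_below_def)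
  show ?thesis
    unfolding specialise_minor[OF n] im
  proof (rule det_submatrix_matching[OF mat_carrier bd inj])
    fix p q assume pq: "p \<in> fst ` ?D" "q \<in> snd ` ?D"
    then have "p < sum_list r" "q < sum_list r" using bd by blast+
    moreover have "(p, q) \<in> roots_m r \<and> (p, q) \<in> E \<longleftrightarrow> (p, q) \<in> ?D"
      using E[unfolded im, OF pq] D by blast
    ultimately show "mat (sum_list r) (sum_list r) (\<lambda>v. of_bool (v \<in> roots_m r \<and> v \<in> E)) $$ (p, q) =
      (of_bool ((p, q) \<in> ?D) :: 'k mpol)" by (simp only: index_mat)
  qed
qed

lemma specialise_minor_zero:
  assumes n: "a < sum_list r" "b < sum_list r"
    and E: "\<And>q. q \<in> insert b (snd ` base_below r (a, b)) \<Longrightarrow> (a, q) \<notin> E"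
  shows "specialise E (minor r (a, b) :: 'k::comm_ring_1 mpol) = 0"
proof -
  let ?I = "insert a (fst ` base_below r (a, b))" and ?J = "insert b (snd ` base_below r (a, b))"
  let ?A = "mat (sum_list r) (sum_list r) (\<lambda>v. of_bool (v \<in> roots_m r \<and> v \<in> E)) :: 'k mpol mat"
  note bd = base_below_bounds[OF n]
  let ?k = "Suc (card (base_below r (a, b)))" and ?u = "card {p \<in> ?I. p < a}"
  have A: "?A \<in> carrier_mat (sum_list r) (sum_list r)" by simp
  note S = submatrix_eq_mat[OF A bd, unfolded base_below_insert_card]
  have u: "pick ?I ?u = a" by (rule pick_card_in_set) simp
  have "finite ?I" using finite_subset[OF bd(1)] by simp
  then have "?u < card ?I" by (intro psubset_card_mono) auto
  then have uk: "?u < ?k" by (simp only: base_below_insert_card)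
  have "submatrix ?A ?I ?J $$ (?u, v) = 0" if "v < ?k" for v
  proof -
    have "pick ?J v \<in> ?J" using that pick_in_set base_below_insert_card by metis
    then have "(a, pick ?J v) \<notin> E" "pick ?J v < sum_list r" using E bd by blast+
    then show ?thesis using that n uk unfolding S by (simp add: u del: insert_iff)
  qed
  then have "det (submatrix ?A ?I ?J) = 0"
    using laplace_expansion_row[of "submatrix ?A ?I ?J" ?k ?u] uk unfolding S by simp
  then show ?thesis by (simp add: specialise_minor[OF n])
qed

text \<open>
  A row contains at most one base root, so on rows that already meet a set of base roots the base agrees
  with this set.
\<close>

lemma base_row_determined:
  assumes "D \<subseteq> base r" "p \<in> fst ` D"
  shows "(p, q) \<in> base r \<longleftrightarrow> (p, q) \<in> D"
proof
  obtain q' where q': "(p, q') \<in> D" using assms(2) by auto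
  assume "(p, q) \<in> base r"
  then have "q = q'" using base_row_col[of p q r p q'] q' assms(1) by blast
  then show "(p, q) \<in> D" using q' by simp
qed (use assms in blast)

lemma minor_base_nonzero:
  assumes "(i, j) \<in> base r"
  shows "(minor r (i, j) :: 'k::idom mpol) \<noteq> 0"
proof -
  have "specialise (base r) (minor r (i, j) :: 'k mpol) \<noteq> 0"
  proof (rule specialise_minor_nonzero)
    show "(i, j) \<in> roots_m r" using assms base_bounds by blast
  next
    fix p q assume p: "p \<in> insert i (fst ` base_below r (i, j))"
    have bb: "base_below r (i, j) \<subseteq> base r" by (auto simp: base_below_def)
    show "(p, q) \<in> base r \<longleftrightarrow> (p, q) \<in> insert (i, j) (base_below r (i, j))"
      using base_row_determined[of "insert (i, j) (base_below r (i, j))"] p bb assms by simp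
  qed
  then show ?thesis by (auto simp: specialise_def poly_subst_0)
qed

text \<open>
  The specialisation keeps the base outside row \<open>j\<close> and replaces row \<open>j\<close> by the single root \<open>(j, l)\<close>.
  Row \<open>i\<close> then has its only entry in column \<open>j\<close>, which kills \<open>M\<^sub>i\<^sub>m\<close> for \<open>m > j\<close>; the term for
  \<open>m = j\<close> becomes a product of two determinants of permutation matrices.
\<close>

lemma L_poly_nonzero:
  assumes ij: "(i, j) \<in> base r" and kl: "(k, l) \<in> base r" and jk: "(j, k) \<in> roots_r r"
  shows "(L_poly r (j, l) :: 'k::idom mpol) \<noteq> 0"
proof -
  have b: "same_block r j k" "j < k" using jk by (auto simp: roots_r_def pos_roots_def)
  note bd = base_bounds[OF ij] base_bounds[OF kl]
  define E where "E = insert (j, l) {(p, q) \<in> base r. p \<noteq> j}"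
  have jl: "(j, l) \<in> roots_m r" using roots_m_row_cong[OF b(1)] b(2) bd(2) by simp
  have bb: "base_below r \<gamma> \<subseteq> base r" for \<gamma> by (auto simp: base_below_def)
  let ?s = "specialise E :: 'k mpol \<Rightarrow> 'k mpol"
  have "?s (L_poly r (j, l)) = (\<Sum>m\<in>{j..k}. ?s (minor r (i, m)) * ?s (minor r (m, l)))"
    unfolding L_poly_eq[OF assms] by (simp add: specialise_def poly_subst_sum poly_subst_mult)
  also have "\<dots> = (\<Sum>m\<in>{j}. ?s (minor r (i, m)) * ?s (minor r (m, l)))"
  proof (rule sum.mono_neutral_right)
    show "\<forall>m\<in>{j..k} - {j}. ?s (minor r (i, m)) * ?s (minor r (m, l)) = 0"
    proof
      fix m assume m: "m \<in> {j..k} - {j}"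
      have "base_below r (i, m) = base_below r (i, j)"
        using base_below_col_cong[OF ij] same_block_between[OF b(1), of m] m by auto
      then have "j \<notin> insert m (snd ` base_below r (i, m))" using m by (auto simp: base_below_def)
      moreover have "(i, q) \<in> E \<Longrightarrow> q = j" for q
        using base_row_col[OF ij] bd(1) by (auto simp: E_def)
      ultimately have "?s (minor r (i, m)) = 0"
        using bd m by (intro specialise_minor_zero) auto
      then show "?s (minor r (i, m)) * ?s (minor r (m, l)) = 0" by simp
    qed
  qed (use b in auto)
  also have "\<dots> = ?s (minor r (i, j)) * ?s (minor r (j, l))" by simp
  also have "\<dots> \<noteq> 0"
  proof -
    have "?s (minor r (i, j)) \<noteq> 0"
    proof (rule specialise_minor_nonzero)
      show "(i, j) \<in> roots_m r" using bd by blast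
    next
      fix p q assume p: "p \<in> insert i (fst ` base_below r (i, j))"
      then have "p < j" using bd base_bounds by (auto simp: base_below_def dest!: base_bounds)
      then show "(p, q) \<in> E \<longleftrightarrow> (p, q) \<in> insert (i, j) (base_below r (i, j))"
        using base_row_determined[of "insert (i, j) (base_below r (i, j))"] p bb ij by (simp add: E_def)
    qed
    moreover have "?s (minor r (j, l)) \<noteq> 0"
    proof (rule specialise_minor_nonzero[OF jl])
      fix p q assume p: "p \<in> insert j (fst ` base_below r (j, l))"
      show "(p, q) \<in> E \<longleftrightarrow> (p, q) \<in> insert (j, l) (base_below r (j, l))"
      proof (cases "p = j")
        case True
        then show ?thesis by (auto simp: E_def base_below_def)
      next
        case False
        then show ?thesis using base_row_determined[of "base_below r (j, l)"] p bb by (simp add: E_def)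
      qed
    qed
    ultimately show ?thesis by simp
  qed
  finally show ?thesis by (auto simp: specialise_def poly_subst_0)
qed

section \<open>Invariance\<close>

lemma PhiE:
  assumes "(j, l) \<in> Phi r"
  obtains i k where "(i, j) \<in> base r" "(k, l) \<in> base r" "(j, k) \<in> roots_r r"
  using assms by (auto simp: Phi_def admissible_def pair_root_def)

lemma Fract_in_rat_invariants:
  fixes N D :: "'k::field mpol"
  assumes "N \<in> poly_m r" "D \<in> poly_m r" "D \<noteq> 0"
    and N: "\<And>g. g \<in> borel_subgroup (sum_list r) \<Longrightarrow> act_poly r g N = Cst (c g) * N"
    and D: "\<And>g. g \<in> borel_subgroup (sum_list r) \<Longrightarrow> act_poly r g D = Cst (c g) * D"
  shows "Fract N D \<in> rat_invariants r (borel_subgroup (sum_list r))"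
proof -
  have "act_rat r g (Fract N D) = Fract N D" if g: "g \<in> borel_subgroup (sum_list r)" for g
  proof -
    have "act_poly r g D \<noteq> 0" using inj_act_poly[OF g] assms(3) act_poly_hom(3)[of r g] by (metis injD)
    then show ?thesis using assms(3) N[OF g] D[OF g] by (simp add: act_rat_Fract[OF g] eq_fract mult_ac)
  qed
  then show ?thesis using assms(1-3) by (auto simp: rat_invariants_def rat_m_def)
qed

theorem lemma3p2:
  fixes r :: "nat list" and n i j a b :: nat
  assumes "0 \<notin> set r" and "sum_list r = n"
    and "(i, b) \<in> Psi1 r"
    and "i < j" and "a < b"
    and "{(i, a), (j, a), (j, b)} \<subseteq> base r \<union> Phi r"
  shows "(A_denom r (i, a) (j, a) (j, b) :: 'k::{alg_closed_field, field_char_0} mpol) \<noteq> 0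
    \<and> (A_rat r (i, b) (i, a) (j, a) (j, b) :: 'k mrat) \<in> rat_invariants r (borel_subgroup n)"
proof -
  have bl: "same_block r x y \<and> x < y" if "(x, y) \<in> roots_r r" for x y
    using that by (auto simp: roots_r_def pos_roots_def)
  (* Since the base decreases along a block, (i, a) and (j, a) lie outside it, hence in Phi r. *)
  have "(i, b) \<in> Phi r" using assms(3) by (simp add: Psi1_def)
  then obtain p q where ib: "(p, i) \<in> base r" "(q, b) \<in> base r" "(i, q) \<in> roots_r r" by (rule PhiE)
  have "(i, a) \<notin> base r"
    using base_antitone_row[of i a r q b] ib(2) bl[OF ib(3)] assms(5) by force
  then have "(i, a) \<in> Phi r" using assms(6) by simp
  then obtain p1 q' where "(p1, i) \<in> base r" and ia: "(q', a) \<in> base r" "(i, q') \<in> roots_r r" by (rule PhiE)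
  have "(j, a) \<notin> base r"
  proof
    assume ja: "(j, a) \<in> base r"
    then have "(j, b) \<notin> base r" using base_row_col assms(5) by blast
    then have "(j, b) \<in> Phi r" using assms(6) by simp
    then obtain p2 k where "(p2, j) \<in> base r" and k: "(k, b) \<in> base r" "(j, k) \<in> roots_r r" by (rule PhiE)
    then show False using base_antitone_row[OF ja k(1)] bl[OF k(2)] assms(5) by simp
  qed
  then have "(j, a) \<in> Phi r" using assms(6) by simp
  then obtain p' q2 where ja: "(p', j) \<in> base r" "(q2, a) \<in> base r" "(j, q2) \<in> roots_r r" by (rule PhiE)
  have "q2 = q'" using base_row_col[OF ja(2) ia(1)] by simp
  note ja = ja[unfolded this]
  (* The weight of the numerator, grouped by the four base roots in the columns i, b, j, a. *)
  define c where "c = (\<lambda>g :: 'k mat. let h = inv\<^bsub>ring_mat TYPE('k) (sum_list r) ()\<^esub> g; w = base_weight r g in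
    (w (p, i) * h $$ (p, p)) * (w (q, b) * g $$ (b, b)) * (w (p', j) * h $$ (p', p')) * (w (q', a) * g $$ (a, a)))"
  have num: "act_poly r g (L_poly r (i, b) * L_poly r (j, a)) = Cst (c g) * (L_poly r (i, b) * L_poly r (j, a))"
    if g: "g \<in> borel_subgroup (sum_list r)" for g :: "'k mat"
    unfolding act_poly_hom act_L_poly[OF g ib] act_L_poly[OF g ja] by (simp add: c_def Let_def Cst_simps mult_ac)
  have num_m: "(L_poly r (i, b) * L_poly r (j, a) :: 'k mpol) \<in> poly_m r"
    by (intro poly_m_closed L_poly_in_poly_m[OF ib] L_poly_in_poly_m[OF ja])
  show ?thesis
  proof (cases "(j, b) \<in> Phi r")
    case True
    then obtain p3 q3 where jb: "(p3, j) \<in> base r" "(q3, b) \<in> base r" "(j, q3) \<in> roots_r r" by (rule PhiE)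
    have eq: "p3 = p'" "q3 = q" using base_row_col[OF jb(1) ja(1)] base_row_col[OF jb(2) ib(2)] by simp_all
    note jb = jb[unfolded eq]
    have den: "A_denom r (i, a) (j, a) (j, b) = (L_poly r (i, a) * L_poly r (j, b) :: 'k mpol)"
      using True by (simp add: A_denom_def)
    have nz: "(L_poly r (i, a) * L_poly r (j, b) :: 'k mpol) \<noteq> 0"
      using L_poly_nonzero[OF ib(1) ia] L_poly_nonzero[OF jb] by simp
    have "(A_rat r (i, b) (i, a) (j, a) (j, b) :: 'k mrat) \<in> rat_invariants r (borel_subgroup (sum_list r))"
      unfolding A_rat_def den
    proof (rule Fract_in_rat_invariants[OF num_m _ nz num])
      fix g :: "'k mat" assume g: "g \<in> borel_subgroup (sum_list r)"
      show "act_poly r g (L_poly r (i, a) * L_poly r (j, b)) = Cst (c g) * (L_poly r (i, a) * L_poly r (j, b))"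
        unfolding act_poly_hom act_L_poly[OF g ib(1) ia] act_L_poly[OF g jb]
        by (simp add: c_def Let_def Cst_simps mult_ac)
    qed (intro poly_m_closed L_poly_in_poly_m[OF ib(1) ia] L_poly_in_poly_m[OF jb])
    then show ?thesis using nz assms(2) by (simp add: den)
  next
    case False
    then have jb: "(j, b) \<in> base r" using assms(6) by simp
    have qj: "q = j" using base_row_col[OF ib(2) jb] by simp
    have jj: "same_block r j j" "j < sum_list r" using same_block_between[of r j q' j] bl[OF ja(3)] base_bounds[OF jb] by simp_all
    have pair: "fst (adm_pair r (j, a)) = (p', j)"
      using adm_pair_eq[of r "((p', j), (q', a))"] ja by (simp add: admissible_def pair_root_def)
    have den: "A_denom r (i, a) (j, a) (j, b) = (L_poly r (i, a) * minor r (p', j) * minor r (j, b) :: 'k mpol)"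
      using False by (simp add: A_denom_def pair)
    have nz: "(L_poly r (i, a) * minor r (p', j) * minor r (j, b) :: 'k mpol) \<noteq> 0"
      using L_poly_nonzero[OF ib(1) ia] minor_base_nonzero[OF ja(1)] minor_base_nonzero[OF jb] by simp
    have den_m: "(L_poly r (i, a) * minor r (p', j) * minor r (j, b) :: 'k mpol) \<in> poly_m r"
      using base_bounds[OF jb] base_bounds[OF ja(1)]
      by (intro poly_m_closed minor_in_poly_m L_poly_in_poly_m[OF ib(1) ia]) simp_all
    have "(A_rat r (i, b) (i, a) (j, a) (j, b) :: 'k mrat) \<in> rat_invariants r (borel_subgroup (sum_list r))"
      unfolding A_rat_def den
    proof (rule Fract_in_rat_invariants[OF num_m den_m nz num])
      fix g :: "'k mat" assume g: "g \<in> borel_subgroup (sum_list r)"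
      let ?h = "inv\<^bsub>ring_mat TYPE('k) (sum_list r) ()\<^esub> g" and ?w = "base_weight r g"
      have m1: "act_poly r g (minor r (p', j)) = Cst (?w (p', j) * ?h $$ (p', p')) * (Cst (g $$ (j, j)) * minor r (p', j))"
        using act_minor_col[OF g ja(1) jj, of j] by simp
      have m2: "act_poly r g (minor r (j, b)) = Cst (?w (j, b) * g $$ (b, b)) * (Cst (?h $$ (j, j)) * minor r (j, b))"
        using act_minor_row[OF g jb jj(1), of j] by simp
      have "act_poly r g (L_poly r (i, a) * minor r (p', j) * minor r (j, b)) =
        Cst (g $$ (j, j) * ?h $$ (j, j)) * (Cst (c g) * (L_poly r (i, a) * minor r (p', j) * minor r (j, b)))"
        unfolding act_poly_hom act_L_poly[OF g ib(1) ia] m1 m2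
        by (simp add: c_def Let_def qj Cst_simps mult_ac)
      then show "act_poly r g (L_poly r (i, a) * minor r (p', j) * minor r (j, b)) =
        Cst (c g) * (L_poly r (i, a) * minor r (p', j) * minor r (j, b))"
        unfolding borel_inv_diag[OF g jj(2)] Cst_simps(2) mult_1_left .
    qed
    then show ?thesis using nz assms(2) by (simp add: den)
  qed
qed

end
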